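(* Let $x$ be an arbitrary function in $L^2(\mathbb{R}^{+})$ and let $\mathscr{F}_{\mathbb{R}^{+}}x$ be its truncated Fourier--Plancherel transform. Write $Ux=\begin{bmatrix} y_{+}\\ y_{-}\end{bmatrix}$ and $U\mathscr{F}_{\mathbb{R}^{+}}x=\begin{bmatrix} z_{+}\\ z_{-}\end{bmatrix}$. Then \[ (U\mathscr{F}_{\mathbb{R}^{+}}x)(\mu)=F(\mu)\,(Ux)(\mu),\quad \mu\in\mathbb{R}^{+},\qquad F(\mu)=\begin{bmatrix}0&F_{+-}(\mu)\\ F_{-+}(\mu)&0\end{bmatrix}, \] i.e. $z_{+}(\mu)=F_{+-}(\mu)\,y_{-}(\mu)$ and $z_{-}(\mu)=F_{-+}(\mu)\,y_{+}(\mu)$ for $\mu\in\mathbb{R}^{+}$, where \[ F_{+-}(\mu)=\frac{1}{\sqrt{2\pi}}\,e^{i\pi/4}e^{-\frac{\pi}{2}\mu}\,\Gamma\big(\tfrac12+i\mu\big),\qquad F_{-+}(\mu)=\frac{1}{\sqrt{2\pi}}\,e^{i\pi/4}e^{\frac{\pi}{2}\mu}\,\Gamma\big(\tfrac12-i\mu\big),\qquad \mu\in\mathbb{R}^{+}. \]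
   Context: The truncated Fourier--Plancherel operator on $L^2(\mathbb{R}^{+})$ is $(\mathscr{F}_{\mathbb{R}^{+}}x)(t)=\frac{1}{\sqrt{2\pi}}\int_{\mathbb{R}^{+}}x(\xi)e^{it\xi}\,d\xi$, $t\in\mathbb{R}^{+}$. The model space $\mathfrak{M}$ is the space of $2\times1$ columns $\begin{bmatrix}\varphi_{+}\\ \varphi_{-}\end{bmatrix}$ with $\varphi_{\pm}\in L^2(\mathbb{R}^{+})$, with inner product $\langle\varphi_{+},\psi_{+}\rangle_{L^2(\mathbb{R}^{+})}+\langle\varphi_{-},\psi_{-}\rangle_{L^2(\mathbb{R}^{+})}$. For $x\in L^2(\mathbb{R}^{+})$ with $\int_{\mathbb{R}^{+}}|x(\xi)|\xi^{-1/2}d\xi<\infty$, define $Ux=\begin{bmatrix}(Ux)_{+}\\(Ux)_{-}\end{bmatrix}$ by $(Ux)_{\pm}(\mu)=\frac{1}{\sqrt{2\pi}}\int_{\mathbb{R}^{+}}x(\xi)\,\xi^{-1/2}\xi^{\pm i\mu}\,d\xi$, $\mu\in\mathbb{R}^{+}$ (with $\xi^{\zeta}=e^{\zeta\ln\xi}$, $\ln\xi$ real); this is isometric on this dense subspace and $U$ denotes its continuous extension to all of $L^2(\mathbb{R}^{+})$, which is a unitary map of $L^2(\mathbb{R}^{+})$ onto $\mathfrak{M}$ (a Mellin transform on the line $\operatorname{Re}\zeta=1/2$, split into $\mu>0$ and $\mu<0$ halves). *)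

theory Defs
  imports "HOL-Analysis.Analysis"
begin

text \<open>Elements of L^2(R+) are represented by functions real => complex whose values
  on (0,infinity) matter; equality is up to a.e.\<close>

definition L2pos :: "(real \<Rightarrow> complex) \<Rightarrow> bool" where
  "L2pos f \<longleftrightarrow> set_borel_measurable lborel {0<..} f \<and>
     set_integrable lborel {0<..} (\<lambda>t. (cmod (f t))^2)"

definition L2dist :: "(real \<Rightarrow> complex) \<Rightarrow> (real \<Rightarrow> complex) \<Rightarrow> real" where
  "L2dist f g = sqrt (LINT t:{0<..}|lborel. (cmod (f t - g t))^2)"

definition L2conv :: "(nat \<Rightarrow> real \<Rightarrow> complex) \<Rightarrow> (real \<Rightarrow> complex) \<Rightarrow> bool" where
  "L2conv xs x \<longleftrightarrow> (\<lambda>n. L2dist (xs n) x) \<longlonglongrightarrow> 0"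

definition FPint :: "(real \<Rightarrow> complex) \<Rightarrow> real \<Rightarrow> complex" where
  "FPint x t = complex_of_real (1 / sqrt (2*pi)) *
      (LINT \<xi>:{0<..}|lborel. x \<xi> * exp (\<i> * complex_of_real (t * \<xi>)))"

definition FP_dom :: "(real \<Rightarrow> complex) \<Rightarrow> bool" where
  "FP_dom x \<longleftrightarrow> L2pos x \<and> set_integrable lborel {0<..} x"

text \<open>y is the value at x of the continuous extension of FPint to L^2(R+).\<close>
definition is_FP :: "(real \<Rightarrow> complex) \<Rightarrow> (real \<Rightarrow> complex) \<Rightarrow> bool" where
  "is_FP x y \<longleftrightarrow> L2pos y \<and>
     (\<forall>xs. (\<forall>n. FP_dom (xs n)) \<and> L2conv xs x \<longrightarrow> L2conv (\<lambda>n. FPint (xs n)) y)"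

definition FPop :: "(real \<Rightarrow> complex) \<Rightarrow> (real \<Rightarrow> complex)" where
  "FPop x = (SOME y. is_FP x y)"

definition Uint :: "real \<Rightarrow> (real \<Rightarrow> complex) \<Rightarrow> real \<Rightarrow> complex" where
  "Uint s x \<mu> = complex_of_real (1 / sqrt (2*pi)) *
      (LINT \<xi>:{0<..}|lborel. x \<xi> * complex_of_real (\<xi> powr (-1/2)) *
           exp (\<i> * complex_of_real (s * \<mu> * ln \<xi>)))"

definition U_dom :: "(real \<Rightarrow> complex) \<Rightarrow> bool" where
  "U_dom x \<longleftrightarrow> L2pos x \<and> set_integrable lborel {0<..} (\<lambda>\<xi>. cmod (x \<xi>) * \<xi> powr (-1/2))"

text \<open>(p, m) represents the element [p; m] of the model space, the value at x of the
  continuous extension of U (convergence in the model space is componentwise L^2 convergence).\<close>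
definition is_U :: "(real \<Rightarrow> complex) \<Rightarrow> (real \<Rightarrow> complex) \<times> (real \<Rightarrow> complex) \<Rightarrow> bool" where
  "is_U x pm \<longleftrightarrow> L2pos (fst pm) \<and> L2pos (snd pm) \<and>
     (\<forall>xs. (\<forall>n. U_dom (xs n)) \<and> L2conv xs x \<longrightarrow>
        L2conv (\<lambda>n. Uint 1 (xs n)) (fst pm) \<and> L2conv (\<lambda>n. Uint (-1) (xs n)) (snd pm))"

definition Uop :: "(real \<Rightarrow> complex) \<Rightarrow> (real \<Rightarrow> complex) \<times> (real \<Rightarrow> complex)" where
  "Uop x = (SOME pm. is_U x pm)"

definition F_pm :: "real \<Rightarrow> complex" where
  "F_pm \<mu> = complex_of_real (1 / sqrt (2*pi)) * exp (\<i> * complex_of_real (pi/4)) *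
      complex_of_real (exp (- (pi/2) * \<mu>)) * Gamma (1/2 + \<i> * complex_of_real \<mu>)"

definition F_mp :: "real \<Rightarrow> complex" where
  "F_mp \<mu> = complex_of_real (1 / sqrt (2*pi)) * exp (\<i> * complex_of_real (pi/4)) *
      complex_of_real (exp ((pi/2) * \<mu>)) * Gamma (1/2 - \<i> * complex_of_real \<mu>)"

end

theory Submission
  imports Defs "HOL-Probability.Probability" "HOL-Complex_Analysis.Complex_Analysis"
begin

text \<open>
  Interchanging the integrals in \<open>U F x\<close> leaves the inner integral of \<open>t powr (s - 1) * exp (i t \<xi>)\<close>
  over \<open>t > 0\<close> with \<open>s = 1/2 + i \<nu>\<close>. It should equal \<open>\<Gamma>(s) (- i \<xi>) powr (- s)\<close> but converges only
  conditionally. Damping \<open>F x\<close> by \<open>exp (- \<epsilon> t)\<close> makes Fubini's theorem applicable and replaces the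
  inner integral by \<open>\<Gamma>(s) (\<epsilon> - i \<xi>) powr (- s)\<close>; if \<open>x\<close> is a truncation of an \<open>L\<^sup>2\<close> function to a
  compact subinterval of \<open>(0, \<infinity>)\<close>, dominated convergence allows \<open>\<epsilon> \<rightarrow> 0\<close> for every \<open>\<nu>\<close>. The \<open>L\<^sup>2\<close>
  limits defining \<open>U\<close> and \<open>F\<close> agree with pointwise limits almost everywhere along subsequences, which
  gives the identity first for truncations and then for all \<open>x\<close>. The extensions themselves exist
  because \<open>F\<close> and \<open>U\<close> are \<open>L\<^sup>2\<close>-contractions: this is Plancherel's inequality, to which \<open>U\<close> reduces by
  the substitution \<open>\<xi> = exp s\<close>.
\<close>

section \<open>Plancherel's inequality\<close>

text \<open>The constants come from \<open>(- \<i>) powr (- s)\<close>: \<open>- \<i>\<close> has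
  argument \<open>- pi/2\<close>, so for s = 1/2 + i \<nu> this power is
  \<open>exp (\<i> * pi/4) * exp (- pi/2 * \<nu>)\<close>. The other factor of the inner integral,
  \<xi> to the power -1/2 - i \<nu>, is the kernel of U at - \<nu>; that is why F is off-diagonal.
  As \<nu> may have either sign, a single computation at \<nu> = \<mu> and at \<nu> = - \<mu> yields
  both entries, \<open>F_mp \<mu>\<close> being \<open>F_pm (- \<mu>)\<close>. \<open>FPop\<close>
  and \<open>Uop\<close> are chosen by \<open>SOME\<close>, so nothing can be said about them until
  an extension is shown to exist. Existence rests on completeness and on a contraction estimate for
  differences, which is what the inequality half of Plancherel supplies. Constants lost later in the
  squared triangle inequality are harmless, because they only multiply quantities that tend to
  0.\<close>

definition fourier :: "(real \<Rightarrow> complex) \<Rightarrow> real \<Rightarrow> complex" where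
  "fourier f t = (LINT x|lborel. f x * exp (\<i> * complex_of_real (t * x)))"

lemma borel_measurable_fourier [measurable]:
  assumes [measurable]: "f \<in> borel_measurable borel"
  shows "fourier f \<in> borel_measurable borel"
proof -
  have "(\<lambda>t. LINT x|lborel. f x * exp (\<i> * complex_of_real (t * x))) \<in> borel_measurable borel"
    by measurable
  then show ?thesis by (simp add: fourier_def[abs_def])
qed

lemma norm_fourier_le: "cmod (fourier f t) \<le> (LINT x|lborel. cmod (f x))"
  unfolding fourier_def
  by (rule order_trans[OF integral_norm_bound]) (simp add: norm_mult)

lemma integrable_mult_exp_ii:
  assumes "integrable M f" and [measurable]: "g \<in> borel_measurable M"
  shows "integrable M (\<lambda>x. f x * exp (\<i> * complex_of_real (g x)))"
proof (rule Bochner_Integration.integrable_bound[OF assms(1)])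
  show "(\<lambda>x. f x * exp (\<i> * complex_of_real (g x))) \<in> borel_measurable M"
    using borel_measurable_integrable[OF assms(1)] by measurable
qed (simp add: norm_mult)

lemma fourier_diff:
  assumes "integrable lborel f" "integrable lborel g"
  shows "fourier (\<lambda>x. f x - g x) t = fourier f t - fourier g t"
  unfolding fourier_def
  by (subst Bochner_Integration.integral_diff[symmetric])
     (auto intro!: integrable_mult_exp_ii assms simp: left_diff_distrib simp del: of_real_mult)

section \<open>Gaussian summability and the Schur bound\<close>

definition gauss_weight :: "real \<Rightarrow> real \<Rightarrow> real" where
  "gauss_weight n t = exp (- (t / n)\<^sup>2 / 2)"

lemma gauss_weight_measurable [measurable]: "gauss_weight n \<in> borel_measurable borel"
  unfolding gauss_weight_def[abs_def] by measurable

lemma gauss_weight_nonneg [simp]: "0 \<le> gauss_weight n t"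
  by (simp add: gauss_weight_def)

lemma gauss_weight_eq: "n > 0 \<Longrightarrow> gauss_weight n t = n * sqrt (2 * pi) * normal_density 0 n t"
  by (simp add: gauss_weight_def normal_density_def power_divide real_sqrt_mult)

lemma integrable_gauss_weight: "n > 0 \<Longrightarrow> integrable lborel (gauss_weight n)"
  by (subst gauss_weight_eq[THEN ext]) auto

text \<open>Read off from the characteristic function of the standard normal law.\<close>

lemma std_normal_fourier:
  "(LINT t|lborel. complex_of_real (exp (- t\<^sup>2 / 2)) * exp (\<i> * complex_of_real (t * u)))
     = sqrt (2 * pi) * exp (- u\<^sup>2 / 2)"
proof -
  have "complex_of_real (exp (- (u\<^sup>2) / 2)) = char std_normal_distribution u"
    by (simp add: char_std_normal_distribution)
  also have "\<dots> = (LINT x|density lborel (\<lambda>x. ennreal (std_normal_density x)). exp (\<i> * complex_of_real (u * x)))"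
    by (simp add: char_def)
  also have "\<dots> = (LINT x|lborel. std_normal_density x *\<^sub>R exp (\<i> * complex_of_real (u * x)))"
    by (subst integral_density) auto
  also have "\<dots> = (LINT x|lborel. complex_of_real (1 / sqrt (2 * pi)) *
       (complex_of_real (exp (- x\<^sup>2 / 2)) * exp (\<i> * complex_of_real (x * u))))"
    by (intro Bochner_Integration.integral_cong)
       (auto simp: std_normal_density_def scaleR_conv_of_real mult_ac)
  also have "\<dots> = complex_of_real (1 / sqrt (2 * pi)) *
      (LINT x|lborel. complex_of_real (exp (- x\<^sup>2 / 2)) * exp (\<i> * complex_of_real (x * u)))"
    by simp
  finally show ?thesis
    by (simp add: field_simps)
qed

text \<open>Rescaling by \<open>n\<close> turns a weight of width \<open>n\<close> into a kernel of
  width \<open>1/n\<close>. The kernel has total mass \<open>2 * pi\<close> for every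
  \<open>n\<close>, which is the constant of Plancherel's inequality.\<close>

lemma gauss_weight_fourier:
  assumes "n > 0"
  shows "(LINT t|lborel. complex_of_real (gauss_weight n t) * exp (\<i> * complex_of_real (t * (x - y))))
     = complex_of_real (2 * pi * normal_density y (1/n) x)"
proof -
  have "(LINT t|lborel. complex_of_real (gauss_weight n t) * exp (\<i> * complex_of_real (t * (x - y))))
    = n *\<^sub>R (LINT t|lborel. complex_of_real (gauss_weight n (0 + n * t)) * exp (\<i> * complex_of_real ((0 + n * t) * (x - y))))"
    using assms by (subst lborel_integral_real_affine[where c=n and t=0]) auto
  also have "\<dots> = n *\<^sub>R (LINT t|lborel. complex_of_real (exp (- t\<^sup>2 / 2)) * exp (\<i> * complex_of_real (t * (n * (x - y)))))"
    using assms by (simp add: gauss_weight_def mult_ac)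
  also have "\<dots> = complex_of_real (n * sqrt (2 * pi) * exp (- (n * (x - y))\<^sup>2 / 2))"
    by (subst std_normal_fourier) (simp add: scaleR_conv_of_real mult_ac)
  also have "n * sqrt (2 * pi) * exp (- (n * (x - y))\<^sup>2 / 2) = 2 * pi * normal_density y (1/n) x"
  proof -
    have "sqrt (2 * pi * (1 / n)\<^sup>2) = sqrt (2 * pi) / n"
      using assms by (simp add: real_sqrt_mult real_sqrt_divide power_divide)
    moreover have "(x - y)\<^sup>2 / (2 * (1 / n)\<^sup>2) = (n * (x - y))\<^sup>2 / 2"
      using assms by (simp add: power_divide power_mult_distrib)
    ultimately have nd: "normal_density y (1/n) x = n / sqrt (2 * pi) * exp (- (n * (x - y))\<^sup>2 / 2)"
      by (simp only: normal_density_def minus_divide_left[symmetric]) simp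
    have "2 * pi / sqrt (2 * pi) = sqrt (2 * pi)"
      by (rule real_div_sqrt) simp
    then have "2 * pi * (n / sqrt (2 * pi) * c) = n * sqrt (2 * pi) * c" for c
      by (metis mult.assoc mult.commute times_divide_eq_left)
    then show ?thesis
      by (simp add: nd)
  qed
  finally show ?thesis .
qed

lemma nn_integral_normal_density:
  "\<sigma> > 0 \<Longrightarrow> (\<integral>\<^sup>+x. ennreal (normal_density \<mu> \<sigma> x) \<partial>lborel) = 1"
  by (subst nn_integral_eq_integral) auto

lemma measurable_normal_density2 [measurable]:
  assumes [measurable]: "f \<in> borel_measurable M" "g \<in> borel_measurable M"
  shows "(\<lambda>w. normal_density (f w) \<sigma> (g w)) \<in> borel_measurable M"
  unfolding normal_density_def by measurable

lemma normal_density_sym: "normal_density x \<sigma> y = normal_density y \<sigma> x"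
  by (simp add: normal_density_def power2_commute)

text \<open>Schur test: \<open>|f(x) f(y)| \<le> (|f(x)|\<^sup>2 + |f(y)|\<^sup>2) / 2\<close>, and the Gaussian kernel has mass \<open>1\<close> in each variable.\<close>

lemma schur_normal_density:
  fixes f :: "real \<Rightarrow> complex"
  assumes [measurable]: "f \<in> borel_measurable borel" and s: "\<sigma> > 0"
  shows "(\<integral>\<^sup>+y. (\<integral>\<^sup>+x. ennreal (cmod (f y) * (cmod (f x) * normal_density y \<sigma> x)) \<partial>lborel) \<partial>lborel)
     \<le> (\<integral>\<^sup>+x. ennreal ((cmod (f x))\<^sup>2) \<partial>lborel)"
proof -
  define E where "E = (\<integral>\<^sup>+x. ennreal ((cmod (f x))\<^sup>2) \<partial>lborel)"
  have "(\<integral>\<^sup>+y. (\<integral>\<^sup>+x. ennreal (cmod (f y) * (cmod (f x) * normal_density y \<sigma> x)) \<partial>lborel) \<partial>lborel)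
    \<le> (\<integral>\<^sup>+y. (\<integral>\<^sup>+x. (ennreal ((cmod (f y))\<^sup>2 / 2) * ennreal (normal_density y \<sigma> x)
        + ennreal ((cmod (f x))\<^sup>2 / 2) * ennreal (normal_density y \<sigma> x)) \<partial>lborel) \<partial>lborel)"
  proof (intro nn_integral_mono)
    fix x y
    have "2 * (cmod (f y) * cmod (f x)) \<le> (cmod (f y))\<^sup>2 + (cmod (f x))\<^sup>2"
      using sum_squares_bound[of "cmod (f y)" "cmod (f x)"] by simp
    then have "(cmod (f y) * cmod (f x)) * normal_density y \<sigma> x
       \<le> ((cmod (f y))\<^sup>2 / 2 + (cmod (f x))\<^sup>2 / 2) * normal_density y \<sigma> x"
      by (intro mult_right_mono) auto
    then show "ennreal (cmod (f y) * (cmod (f x) * normal_density y \<sigma> x))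
      \<le> ennreal ((cmod (f y))\<^sup>2 / 2) * ennreal (normal_density y \<sigma> x)
        + ennreal ((cmod (f x))\<^sup>2 / 2) * ennreal (normal_density y \<sigma> x)"
      by (simp add: ennreal_mult''[symmetric] ennreal_plus[symmetric] distrib_right mult.assoc del: ennreal_plus)
  qed
  also have "\<dots> = (\<integral>\<^sup>+y. (\<integral>\<^sup>+x. ennreal ((cmod (f y))\<^sup>2 / 2) * ennreal (normal_density y \<sigma> x) \<partial>lborel) \<partial>lborel)
      + (\<integral>\<^sup>+y. (\<integral>\<^sup>+x. ennreal ((cmod (f x))\<^sup>2 / 2) * ennreal (normal_density y \<sigma> x) \<partial>lborel) \<partial>lborel)"
    by (simp add: nn_integral_add)
  also have "(\<integral>\<^sup>+y. (\<integral>\<^sup>+x. ennreal ((cmod (f x))\<^sup>2 / 2) * ennreal (normal_density y \<sigma> x) \<partial>lborel) \<partial>lborel)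
     = (\<integral>\<^sup>+x. (\<integral>\<^sup>+y. ennreal ((cmod (f x))\<^sup>2 / 2) * ennreal (normal_density y \<sigma> x) \<partial>lborel) \<partial>lborel)"
    by (rule lborel_pair.Fubini') measurable
  also have "(\<integral>\<^sup>+x. (\<integral>\<^sup>+y. ennreal ((cmod (f x))\<^sup>2 / 2) * ennreal (normal_density y \<sigma> x) \<partial>lborel) \<partial>lborel)
     = (\<integral>\<^sup>+x. ennreal ((cmod (f x))\<^sup>2 / 2) \<partial>lborel)"
  proof (rule nn_integral_cong)
    fix x
    show "(\<integral>\<^sup>+y. ennreal ((cmod (f x))\<^sup>2 / 2) * ennreal (normal_density y \<sigma> x) \<partial>lborel) = ennreal ((cmod (f x))\<^sup>2 / 2)"
      unfolding normal_density_sym[of _ \<sigma> x]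
      by (simp add: nn_integral_cmult nn_integral_normal_density s)
  qed
  also have "(\<integral>\<^sup>+y. (\<integral>\<^sup>+x. ennreal ((cmod (f y))\<^sup>2 / 2) * ennreal (normal_density y \<sigma> x) \<partial>lborel) \<partial>lborel)
     = (\<integral>\<^sup>+x. ennreal ((cmod (f x))\<^sup>2 / 2) \<partial>lborel)"
    by (simp add: nn_integral_cmult nn_integral_normal_density s)
  also have "(\<integral>\<^sup>+x. ennreal ((cmod (f x))\<^sup>2 / 2) \<partial>lborel) + (\<integral>\<^sup>+x. ennreal ((cmod (f x))\<^sup>2 / 2) \<partial>lborel)
     = (\<integral>\<^sup>+x. (ennreal ((cmod (f x))\<^sup>2 / 2) + ennreal ((cmod (f x))\<^sup>2 / 2)) \<partial>lborel)"
    by (simp add: nn_integral_add)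
  also have "\<dots> = (\<integral>\<^sup>+x. ennreal ((cmod (f x))\<^sup>2) \<partial>lborel)"
    by (simp flip: ennreal_plus)
  finally show ?thesis .
qed

text \<open>By Tonelli a product of integrable functions of separate variables is integrable on the
  plane, and a bounded kernel keeps it so. Every interchange below has this shape, with a unimodular
  exponential as \<open>k\<close>.\<close>

lemma Fubini_mult_bounded:
  fixes f g :: "real \<Rightarrow> complex" and k :: "real \<Rightarrow> real \<Rightarrow> complex"
  assumes f: "integrable lborel f" and g: "integrable lborel g"
    and k [measurable]: "case_prod k \<in> borel_measurable (lborel \<Otimes>\<^sub>M lborel)"
    and bd: "\<And>x y. cmod (k x y) \<le> 1"
  shows "(LINT y|lborel. (LINT x|lborel. f x * g y * k x y)) = (LINT x|lborel. (LINT y|lborel. f x * g y * k x y))"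
proof (rule lborel_pair.Fubini_integral)
  have [measurable]: "f \<in> borel_measurable borel" "g \<in> borel_measurable borel"
    using f g by auto
  have "integrable (lborel \<Otimes>\<^sub>M lborel) (\<lambda>(x, y). f x * g y)"
  proof (rule lborel_pair.Fubini_integrable)
    show "integrable lborel (\<lambda>x. LINT y|lborel. norm (case (x, y) of (x, y) \<Rightarrow> f x * g y))"
      using f by (simp add: norm_mult)
    show "AE x in lborel. integrable lborel (\<lambda>y. case (x, y) of (x, y) \<Rightarrow> f x * g y)"
      using g by simp
  qed simp
  then show "integrable (lborel \<Otimes>\<^sub>M lborel) (\<lambda>(x, y). f x * g y * k x y)"
    by (rule Bochner_Integration.integrable_bound)
       (auto simp: norm_mult intro!: AE_I2 mult_left_le bd)
qed

text \<open>If \<open>f\<close> is not integrable the left side is 0 by convention, so inner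
  integrals can be estimated before anything is known about their convergence.\<close>

lemma integral_norm_bound_nn:
  fixes f :: "'a \<Rightarrow> complex"
  shows "ennreal (cmod (LINT x|M. f x)) \<le> (\<integral>\<^sup>+x. ennreal (cmod (f x)) \<partial>M)"
  by (cases "integrable M f") (auto simp: not_integrable_integral_eq intro: integral_norm_bound_ennreal)

text \<open>The square is expanded as \<open>fourier f\<close> times its conjugate, and the integral
  over \<open>t\<close> is moved inside. Without the weight that integral would be a delta function
  in \<open>x - y\<close>; the weight makes both interchanges absolutely convergent and puts a
  narrow Gaussian in place of the delta.\<close>

lemma gauss_weight_fourier_sq:
  assumes f: "integrable lborel f" and n: "n > 0"
  shows "(LINT t|lborel. complex_of_real (gauss_weight n t * (cmod (fourier f t))\<^sup>2))
     = (LINT y|lborel. (LINT x|lborel. cnj (f y) * (f x * complex_of_real (2 * pi * normal_density y (1/n) x))))"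
proof -
  have [measurable]: "f \<in> borel_measurable borel"
    using f by auto
  define W where "W = (\<lambda>t. complex_of_real (gauss_weight n t))"
  have W: "integrable lborel W"
    unfolding W_def using integrable_gauss_weight[OF n] by simp
  \<comment> \<open>\<open>fourier f\<close> is bounded by the integral of
    \<open>cmod (f x)\<close>, so the integrable weight dominates the product.\<close>
  have W2: "integrable lborel (\<lambda>t. W t * fourier f t)"
  proof (rule Bochner_Integration.integrable_bound)
    show "integrable lborel (\<lambda>t. W t * complex_of_real (LINT x|lborel. cmod (f x)))"
      using W by simp
    show "AE t in lborel. cmod (W t * fourier f t)
        \<le> cmod (W t * complex_of_real (LINT x|lborel. cmod (f x)))"
      by (auto simp: norm_mult intro!: mult_left_mono order_trans[OF norm_fourier_le])
  qed (simp add: W_def)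
  have cf: "integrable lborel (\<lambda>x. cnj (f x))"
    using f by simp
  have "(LINT t|lborel. complex_of_real (gauss_weight n t * (cmod (fourier f t))\<^sup>2))
     = (LINT t|lborel. W t * fourier f t * cnj (fourier f t))"
    unfolding W_def
    by (intro Bochner_Integration.integral_cong refl)
       (simp add: complex_norm_square mult.assoc del: of_real_power)
  also have "\<dots> = (LINT t|lborel. (LINT y|lborel. (W t * fourier f t) * cnj (f y) * exp (- (\<i> * complex_of_real (t * y)))))"
  proof (intro Bochner_Integration.integral_cong refl)
    fix t
    have "(LINT y|lborel. cnj (f y * exp (\<i> * complex_of_real (t * y)))) = cnj (fourier f t)"
      unfolding fourier_def by (rule Bochner_Integration.integral_cnj)
    then have "cnj (fourier f t) = (LINT y|lborel. cnj (f y) * exp (- (\<i> * complex_of_real (t * y))))"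
      by (simp add: exp_cnj)
    then show "W t * fourier f t * cnj (fourier f t) = (LINT y|lborel. W t * fourier f t * cnj (f y) * exp (- (\<i> * complex_of_real (t * y))))"
      by (simp add: mult.assoc)
  qed
  also have "\<dots> = (LINT y|lborel. (LINT t|lborel. (W t * fourier f t) * cnj (f y) * exp (- (\<i> * complex_of_real (t * y)))))"
    by (rule Fubini_mult_bounded[OF W2 cf, symmetric]) auto
  also have "\<dots> = (LINT y|lborel. (LINT x|lborel. cnj (f y) * (f x * complex_of_real (2 * pi * normal_density y (1/n) x))))"
  proof (rule Bochner_Integration.integral_cong[OF refl])
    fix y
    have "(LINT t|lborel. (W t * fourier f t) * cnj (f y) * exp (- (\<i> * complex_of_real (t * y))))
       = cnj (f y) * (LINT t|lborel. (W t * exp (- (\<i> * complex_of_real (t * y)))) * fourier f t)"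
      by (subst integral_mult_right_zero[symmetric]) (simp add: mult_ac)
    also have "(LINT t|lborel. (W t * exp (- (\<i> * complex_of_real (t * y)))) * fourier f t)
       = (LINT t|lborel. (LINT x|lborel. W t * f x * exp (\<i> * complex_of_real (t * (x - y)))))"
      unfolding fourier_def
      by (subst integral_mult_right_zero[symmetric])
         (auto simp: mult_ac algebra_simps simp flip: exp_add intro!: Bochner_Integration.integral_cong)
    also have "\<dots> = (LINT x|lborel. (LINT t|lborel. W t * f x * exp (\<i> * complex_of_real (t * (x - y)))))"
      by (rule Fubini_mult_bounded[OF W f, symmetric]) auto
    also have "\<dots> = (LINT x|lborel. f x * (LINT t|lborel. W t * exp (\<i> * complex_of_real (t * (x - y)))))"
      by (subst integral_mult_right_zero[symmetric]) (simp add: mult_ac)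
    also have "\<dots> = (LINT x|lborel. f x * complex_of_real (2 * pi * normal_density y (1/n) x))"
      unfolding W_def by (subst gauss_weight_fourier[OF n]) simp
    finally show "(LINT t|lborel. (W t * fourier f t) * cnj (f y) * exp (- (\<i> * complex_of_real (t * y))))
       = (LINT x|lborel. cnj (f y) * (f x * complex_of_real (2 * pi * normal_density y (1/n) x)))"
      by simp
  qed
  finally show ?thesis .
qed

text \<open>The bound does not depend on \<open>n\<close>, because the Gaussian kernel has the same
  mass at every width; this uniformity is what the limit over \<open>n\<close> uses.\<close>

lemma nn_gauss_weight_fourier_le:
  assumes f: "integrable lborel f" and n: "n > 0"
  shows "(\<integral>\<^sup>+t. ennreal (gauss_weight n t * (cmod (fourier f t))\<^sup>2) \<partial>lborel)
     \<le> 2 * pi * (\<integral>\<^sup>+x. ennreal ((cmod (f x))\<^sup>2) \<partial>lborel)"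
proof -
  have [measurable]: "f \<in> borel_measurable borel"
    using f by auto
  have int: "integrable lborel (\<lambda>t. gauss_weight n t * (cmod (fourier f t))\<^sup>2)"
  proof (rule Bochner_Integration.integrable_bound)
    show "integrable lborel (\<lambda>t. gauss_weight n t * (LINT x|lborel. cmod (f x))\<^sup>2)"
      using integrable_gauss_weight[OF n] by simp
    show "AE t in lborel. norm (gauss_weight n t * (cmod (fourier f t))\<^sup>2)
        \<le> norm (gauss_weight n t * (LINT x|lborel. cmod (f x))\<^sup>2)"
      by (auto simp: abs_mult intro!: mult_left_mono power_mono norm_fourier_le)
  qed simp
  have "(\<integral>\<^sup>+t. ennreal (gauss_weight n t * (cmod (fourier f t))\<^sup>2) \<partial>lborel)
     = ennreal (LINT t|lborel. gauss_weight n t * (cmod (fourier f t))\<^sup>2)"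
    by (rule nn_integral_eq_integral[OF int]) auto
  also have "(LINT t|lborel. gauss_weight n t * (cmod (fourier f t))\<^sup>2)
     \<le> cmod (complex_of_real (LINT t|lborel. gauss_weight n t * (cmod (fourier f t))\<^sup>2))"
    by simp
  also have "complex_of_real (LINT t|lborel. gauss_weight n t * (cmod (fourier f t))\<^sup>2) =
      (LINT y|lborel. (LINT x|lborel. cnj (f y) * (f x * complex_of_real (2 * pi * normal_density y (1/n) x))))"
    by (simp only: gauss_weight_fourier_sq[OF f n, symmetric] integral_complex_of_real)
  also have "ennreal (cmod \<dots>) \<le> (\<integral>\<^sup>+y. ennreal (cmod (LINT x|lborel. cnj (f y) * (f x * complex_of_real (2 * pi * normal_density y (1/n) x)))) \<partial>lborel)"
    by (rule integral_norm_bound_nn)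
  also have "\<dots> \<le> (\<integral>\<^sup>+y. (\<integral>\<^sup>+x. ennreal (cmod (cnj (f y) * (f x * complex_of_real (2 * pi * normal_density y (1/n) x)))) \<partial>lborel) \<partial>lborel)"
    by (intro nn_integral_mono integral_norm_bound_nn)
  also have "\<dots> = (\<integral>\<^sup>+y. (\<integral>\<^sup>+x. ennreal (2 * pi) * ennreal (cmod (f y) * (cmod (f x) * normal_density y (1/n) x)) \<partial>lborel) \<partial>lborel)"
    by (intro nn_integral_cong) (simp add: norm_mult ennreal_mult[symmetric] mult_ac)
  also have "\<dots> = ennreal (2 * pi) * (\<integral>\<^sup>+y. (\<integral>\<^sup>+x. ennreal (cmod (f y) * (cmod (f x) * normal_density y (1/n) x)) \<partial>lborel) \<partial>lborel)"
    by (simp add: nn_integral_cmult)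
  also have "\<dots> \<le> ennreal (2 * pi) * (\<integral>\<^sup>+x. ennreal ((cmod (f x))\<^sup>2) \<partial>lborel)"
    using n by (intro mult_left_mono schur_normal_density) auto
  finally show ?thesis by (auto simp: ennreal_leI)
qed

text \<open>The weights tend to 1 pointwise, so Fatou's lemma carries the uniform bound to the
  unweighted integral.\<close>

lemma plancherel_le:
  assumes f: "integrable lborel f"
  shows "(\<integral>\<^sup>+t. ennreal ((cmod (fourier f t))\<^sup>2) \<partial>lborel)
     \<le> ennreal (2 * pi) * (\<integral>\<^sup>+x. ennreal ((cmod (f x))\<^sup>2) \<partial>lborel)"
proof -
  have [measurable]: "f \<in> borel_measurable borel"
    using f by auto
  define u where "u = (\<lambda>n t. ennreal (gauss_weight (real (Suc n)) t * (cmod (fourier f t))\<^sup>2))"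
  have [measurable]: "u n \<in> borel_measurable lborel" for n
    unfolding u_def by measurable
  have lim: "(\<lambda>n. u n t) \<longlonglongrightarrow> ennreal ((cmod (fourier f t))\<^sup>2)" for t
  proof -
    have "(\<lambda>n. t / real (Suc n)) \<longlonglongrightarrow> 0"
      by (rule LIMSEQ_Suc[OF lim_const_over_n])
    then have "(\<lambda>n. gauss_weight (real (Suc n)) t) \<longlonglongrightarrow> exp (- (0::real)\<^sup>2 / 2)"
      unfolding gauss_weight_def by (intro tendsto_intros) auto
    then have "(\<lambda>n. gauss_weight (real (Suc n)) t * (cmod (fourier f t))\<^sup>2) \<longlonglongrightarrow> 1 * (cmod (fourier f t))\<^sup>2"
      by (intro tendsto_mult tendsto_const) simp
    then show ?thesis
      unfolding u_def by (intro tendsto_ennrealI) simp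
  qed
  have "(\<integral>\<^sup>+t. ennreal ((cmod (fourier f t))\<^sup>2) \<partial>lborel) = (\<integral>\<^sup>+t. liminf (\<lambda>n. u n t) \<partial>lborel)"
    by (intro nn_integral_cong lim_imp_Liminf[symmetric] lim) simp
  also have "\<dots> \<le> liminf (\<lambda>n. \<integral>\<^sup>+t. u n t \<partial>lborel)"
    by (rule nn_integral_liminf) simp
  also have "\<dots> \<le> ennreal (2 * pi) * (\<integral>\<^sup>+x. ennreal ((cmod (f x))\<^sup>2) \<partial>lborel)"
    unfolding u_def
    by (intro Liminf_le always_eventually allI nn_gauss_weight_fourier_le[OF f]) auto
  finally show ?thesis .
qed

section \<open>Convergence in mean square\<close>

text \<open>Taking values in \<open>ennreal\<close> avoids the convention that a divergent Bochner integral is \<open>0\<close>.\<close>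

definition sq_norm :: "'a measure \<Rightarrow> ('a \<Rightarrow> complex) \<Rightarrow> ennreal" where
  "sq_norm M f = (\<integral>\<^sup>+x. ennreal ((cmod (f x))\<^sup>2) \<partial>M)"

definition sq_conv :: "'a measure \<Rightarrow> (nat \<Rightarrow> 'a \<Rightarrow> complex) \<Rightarrow> ('a \<Rightarrow> complex) \<Rightarrow> bool" where
  "sq_conv M fs f \<longleftrightarrow> (\<lambda>n. sq_norm M (\<lambda>x. fs n x - f x)) \<longlonglongrightarrow> 0"

lemma sq_norm_commute: "sq_norm M (\<lambda>x. f x - g x) = sq_norm M (\<lambda>x. g x - f x)"
  by (simp add: sq_norm_def norm_minus_commute)

lemma sq_norm_add_le:
  assumes [measurable]: "f \<in> borel_measurable M" "g \<in> borel_measurable M"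
  shows "sq_norm M (\<lambda>x. f x + g x) \<le> 2 * sq_norm M f + 2 * sq_norm M g"
proof -
  have *: "(cmod (f x + g x))\<^sup>2 \<le> 2 * (cmod (f x))\<^sup>2 + 2 * (cmod (g x))\<^sup>2" for x
  proof -
    have "(cmod (f x + g x))\<^sup>2 \<le> (cmod (f x) + cmod (g x))\<^sup>2"
      by (intro power_mono norm_triangle_ineq) auto
    also have "\<dots> \<le> 2 * (cmod (f x))\<^sup>2 + 2 * (cmod (g x))\<^sup>2"
      using sum_squares_bound[of "cmod (f x)" "cmod (g x)"] by (simp add: power2_sum)
    finally show ?thesis .
  qed
  have "sq_norm M (\<lambda>x. f x + g x) \<le> (\<integral>\<^sup>+x. (2 * ennreal ((cmod (f x))\<^sup>2) + 2 * ennreal ((cmod (g x))\<^sup>2)) \<partial>M)"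
    unfolding sq_norm_def
  proof (rule nn_integral_mono)
    fix x
    have "ennreal ((cmod (f x + g x))\<^sup>2) \<le> ennreal (2 * (cmod (f x))\<^sup>2 + 2 * (cmod (g x))\<^sup>2)"
      using * by (rule ennreal_leI)
    then show "ennreal ((cmod (f x + g x))\<^sup>2) \<le> 2 * ennreal ((cmod (f x))\<^sup>2) + 2 * ennreal ((cmod (g x))\<^sup>2)"
      by (simp add: ennreal_mult)
  qed
  also have "\<dots> = 2 * sq_norm M f + 2 * sq_norm M g"
    unfolding sq_norm_def by (simp add: nn_integral_add nn_integral_cmult)
  finally show ?thesis .
qed

lemma sq_norm_triangle:
  assumes "f \<in> borel_measurable M" "g \<in> borel_measurable M" "h \<in> borel_measurable M"
  shows "sq_norm M (\<lambda>x. f x - h x) \<le> 2 * sq_norm M (\<lambda>x. f x - g x) + 2 * sq_norm M (\<lambda>x. g x - h x)"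
  using sq_norm_add_le[of "\<lambda>x. f x - g x" M "\<lambda>x. g x - h x"] assms by simp

section \<open>Fast subsequences, completeness and extension by density\<close>

lemma strict_mono_choice:
  assumes "\<And>n. eventually (P n) sequentially"
  shows "\<exists>r::nat \<Rightarrow> nat. strict_mono r \<and> (\<forall>n. P n (r n))"
proof -
  from assms obtain N where N: "\<And>n m. m \<ge> N n \<Longrightarrow> P n m"
    unfolding eventually_sequentially by metis
  \<comment> \<open>The maximum with \<open>Suc k\<close> makes \<open>r\<close> strictly
    increasing, the maximum with \<open>N (Suc n)\<close> puts \<open>r (Suc n)\<close> in the range
    where \<open>P (Suc n)\<close> holds.\<close>
  define r where "r = rec_nat (N 0) (\<lambda>n k. max (Suc k) (N (Suc n)))"
  have "r (Suc n) > r n" for n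
    by (simp add: r_def less_max_iff_disj)
  moreover have "r n \<ge> N n" for n
    by (cases n) (auto simp: r_def)
  ultimately show ?thesis
    using N by (intro exI[of _ r]) (auto simp: strict_mono_Suc_iff)
qed

text \<open>Weighting the squares by \<open>2^n\<close> still leaves integrals of size at most
  \<open>(1/2)^n\<close>, so the weighted series is finite almost everywhere; the weight then pays
  for passing from squares to first powers pointwise, whatever the total mass of
  \<open>M\<close>.\<close>

lemma AE_summable_of_fast_sq_norm:
  assumes g [measurable]: "\<And>n. g n \<in> borel_measurable M"
    and fast: "\<And>n. sq_norm M (g n) \<le> ennreal ((1/4)^n)"
  shows "AE x in M. summable (\<lambda>n. cmod (g n x))"
proof -
  define G where "G = (\<lambda>x. \<Sum>n. ennreal (2^n * (cmod (g n x))\<^sup>2))"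
  have "(\<integral>\<^sup>+x. G x \<partial>M) = (\<Sum>n. \<integral>\<^sup>+x. ennreal (2^n * (cmod (g n x))\<^sup>2) \<partial>M)"
    unfolding G_def by (rule nn_integral_suminf) simp
  also have "\<dots> = (\<Sum>n. ennreal (2^n) * sq_norm M (g n))"
    unfolding sq_norm_def by (simp add: ennreal_mult nn_integral_cmult)
  also have "\<dots> \<le> (\<Sum>n. ennreal ((1/2)^n))"
  proof (rule suminf_le)
    fix n
    have "ennreal (2^n) * sq_norm M (g n) \<le> ennreal (2^n) * ennreal ((1/4)^n)"
      by (intro mult_left_mono fast) simp
    also have "\<dots> = ennreal ((1/2)^n)"
      by (simp add: ennreal_mult[symmetric] power_mult_distrib[symmetric] del: ennreal_power)
    finally show "ennreal (2^n) * sq_norm M (g n) \<le> ennreal ((1/2)^n)" .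
  qed auto
  also have "\<dots> = ennreal (\<Sum>n. (1/2)^n)"
    by (rule suminf_ennreal2) (auto intro: summable_geometric)
  also have "\<dots> < \<infinity>" by simp
  finally have "AE x in M. G x \<noteq> \<infinity>"
    by (intro nn_integral_noteq_infinite) (auto simp: G_def)
  then show ?thesis
  proof (rule AE_mp, intro AE_I2 impI)
    fix x assume "G x \<noteq> \<infinity>"
    then have s1: "summable (\<lambda>n. 2^n * (cmod (g n x))\<^sup>2)"
      unfolding G_def by (intro summable_suminf_not_top) auto
    have s: "summable (\<lambda>n. 2^n * (cmod (g n x))\<^sup>2 + (1/2)^n)"
      by (intro summable_add s1 summable_geometric) simp
    show "summable (\<lambda>n. cmod (g n x))"
    proof (rule summable_comparison_test'[OF s])
      fix n :: nat
      \<comment> \<open>With a = \<open>2^n * cmod (g n x)\<close> this reads 0 \<le> a * a - a + 1.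
        Dividing a \<le> a * a + 1 by \<open>2^n\<close> gives the comparison with the summable
        series.\<close>
      have "0 \<le> (2^n * cmod (g n x) - 1)\<^sup>2 + 2^n * cmod (g n x)"
        by simp
      then have "2^n * cmod (g n x) \<le> 2^n * (2^n * (cmod (g n x))\<^sup>2 + (1/2)^n)"
        by (simp add: power2_eq_square algebra_simps power_divide)
      then show "norm (cmod (g n x)) \<le> 2^n * (cmod (g n x))\<^sup>2 + (1/2)^n"
        by simp
    qed
  qed
qed

lemma sq_conv_AE_subseq:
  assumes [measurable]: "\<And>n. fs n \<in> borel_measurable M" "f \<in> borel_measurable M"
    and "sq_conv M fs f"
  shows "\<exists>r::nat \<Rightarrow> nat. strict_mono r \<and> (AE x in M. (\<lambda>n. fs (r n) x) \<longlonglongrightarrow> f x)"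
proof -
  have "eventually (\<lambda>m. sq_norm M (\<lambda>x. fs m x - f x) \<le> ennreal ((1/4)^n)) sequentially" for n
  proof -
    have "eventually (\<lambda>m. sq_norm M (\<lambda>x. fs m x - f x) < ennreal ((1/4)^n)) sequentially"
      using assms(3) unfolding sq_conv_def by (rule order_tendstoD) simp
    then show ?thesis by (rule eventually_mono) simp
  qed
  from strict_mono_choice[where P="\<lambda>n m. sq_norm M (\<lambda>x. fs m x - f x) \<le> ennreal ((1/4)^n)", OF this]
  obtain r :: "nat \<Rightarrow> nat" where r: "strict_mono r"
    "\<And>n. sq_norm M (\<lambda>x. fs (r n) x - f x) \<le> ennreal ((1/4)^n)" by auto
  have "AE x in M. summable (\<lambda>n. cmod (fs (r n) x - f x))"
    by (rule AE_summable_of_fast_sq_norm) (use r in auto)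
  then have "AE x in M. (\<lambda>n. fs (r n) x) \<longlonglongrightarrow> f x"
  proof (rule AE_mp, intro AE_I2 impI)
    fix x assume "summable (\<lambda>n. cmod (fs (r n) x - f x))"
    then have "(\<lambda>n. cmod (fs (r n) x - f x)) \<longlonglongrightarrow> 0"
      by (rule summable_LIMSEQ_zero)
    then show "(\<lambda>n. fs (r n) x) \<longlonglongrightarrow> f x"
      by (simp only: tendsto_norm_zero_iff LIM_zero_iff)
  qed
  with r show ?thesis by auto
qed

text \<open>Riesz-Fischer at the level of functions: a fast subsequence converges almost everywhere,
  and Fatou's lemma along it turns the Cauchy condition into convergence of the whole
  sequence.\<close>

lemma sq_norm_complete:
  assumes [measurable]: "\<And>n. fs n \<in> borel_measurable M"
    and cauchy: "\<And>e. e > 0 \<Longrightarrow> \<exists>N. \<forall>m\<ge>N. \<forall>n\<ge>N. sq_norm M (\<lambda>x. fs m x - fs n x) < e"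
  shows "\<exists>f\<in>borel_measurable M. sq_conv M fs f"
proof -
  have "eventually (\<lambda>k. \<forall>m\<ge>k. sq_norm M (\<lambda>x. fs m x - fs k x) \<le> ennreal ((1/4)^n)) sequentially" for n
  proof -
    obtain N where "\<forall>m\<ge>N. \<forall>k\<ge>N. sq_norm M (\<lambda>x. fs m x - fs k x) < ennreal ((1/4)^n)"
      using cauchy[of "ennreal ((1/4)^n)"] by auto
    then show ?thesis
      unfolding eventually_sequentially by (intro exI[of _ N]) (auto intro: less_imp_le)
  qed
  from strict_mono_choice[where P="\<lambda>n k. \<forall>m\<ge>k. sq_norm M (\<lambda>x. fs m x - fs k x) \<le> ennreal ((1/4)^n)", OF this]
  obtain r :: "nat \<Rightarrow> nat" where r: "strict_mono r"
    and r2: "\<And>n m. m \<ge> r n \<Longrightarrow> sq_norm M (\<lambda>x. fs m x - fs (r n) x) \<le> ennreal ((1/4)^n)" by auto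
  have "AE x in M. summable (\<lambda>n. cmod (fs (r (Suc n)) x - fs (r n) x))"
    by (rule AE_summable_of_fast_sq_norm)
       (use r in \<open>auto intro!: r2 simp: strict_mono_less_eq\<close>)
  then have conv: "AE x in M. convergent (\<lambda>n. fs (r n) x)"
  proof (rule AE_mp, intro AE_I2 impI)
    fix x assume "summable (\<lambda>n. cmod (fs (r (Suc n)) x - fs (r n) x))"
    then have "summable (\<lambda>n. fs (r (Suc n)) x - fs (r n) x)"
      by (rule summable_norm_cancel)
    then have "convergent (\<lambda>n. \<Sum>i<n. fs (r (Suc i)) x - fs (r i) x)"
      by (simp add: summable_iff_convergent)
    then have "convergent (\<lambda>n. fs (r n) x - fs (r 0) x)"
      using sum_lessThan_telescope[of "\<lambda>n. fs (r n) x"] by simp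
    from convergent_add[OF this convergent_const[of "fs (r 0) x"]] show "convergent (\<lambda>n. fs (r n) x)"
      by simp
  qed
  \<comment> \<open>On the null set where the subsequence diverges \<open>lim\<close> has an
    arbitrary value, yet \<open>f\<close> is measurable as it stands.\<close>
  define f where "f = (\<lambda>x. lim (\<lambda>n. fs (r n) x))"
  have f [measurable]: "f \<in> borel_measurable M"
    unfolding f_def by (rule borel_measurable_lim_metric) simp
  have "sq_conv M fs f"
    unfolding sq_conv_def
  proof (rule order_tendstoI)
    fix e :: ennreal assume "e > 0"
    \<comment> \<open>Fatou's lemma only gives a weak inequality, so room is left below
      \<open>e\<close>.\<close>
    then obtain e' where e': "0 < e'" "e' < e" using dense by blast
    obtain N where N: "\<And>m n. m \<ge> N \<Longrightarrow> n \<ge> N \<Longrightarrow> sq_norm M (\<lambda>x. fs m x - fs n x) < e'"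
      using cauchy[OF e'(1)] by auto
    have "sq_norm M (\<lambda>x. fs n x - f x) < e" if n: "n \<ge> N" for n
    proof -
      have "sq_norm M (\<lambda>x. fs n x - f x)
          = (\<integral>\<^sup>+x. liminf (\<lambda>k. ennreal ((cmod (fs n x - fs (r k) x))\<^sup>2)) \<partial>M)"
        unfolding sq_norm_def
      proof (rule nn_integral_cong_AE, rule AE_mp[OF conv], intro AE_I2 impI)
        fix x assume "convergent (\<lambda>n. fs (r n) x)"
        then have "(\<lambda>n. fs (r n) x) \<longlonglongrightarrow> f x"
          unfolding f_def by (simp add: convergent_LIMSEQ_iff)
        then have "(\<lambda>k. ennreal ((cmod (fs n x - fs (r k) x))\<^sup>2)) \<longlonglongrightarrow> ennreal ((cmod (fs n x - f x))\<^sup>2)"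
          by (intro tendsto_intros)
        then show "ennreal ((cmod (fs n x - f x))\<^sup>2) = liminf (\<lambda>k. ennreal ((cmod (fs n x - fs (r k) x))\<^sup>2))"
          by (intro lim_imp_Liminf[symmetric]) auto
      qed
      also have "\<dots> \<le> liminf (\<lambda>k. sq_norm M (\<lambda>x. fs n x - fs (r k) x))"
        unfolding sq_norm_def by (rule nn_integral_liminf) simp
      also have "\<dots> \<le> e'"
      proof (rule Liminf_le)
        show "eventually (\<lambda>k. sq_norm M (\<lambda>x. fs n x - fs (r k) x) \<le> e') sequentially"
          unfolding eventually_sequentially
          using N[OF n] seq_suble[OF r]
          by (intro exI[of _ N]) (meson less_imp_le order_trans)
      qed simp
      finally show ?thesis using e' by simp
    qed
    then show "eventually (\<lambda>n. sq_norm M (\<lambda>x. fs n x - f x) < e) sequentially"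
      unfolding eventually_sequentially by blast
  qed simp
  with f show ?thesis by blast
qed

text \<open>The factors are \<open>ennreal\<close> of reals and hence finite; multiplication by
  \<open>top\<close> would be discontinuous at 0.\<close>

lemma ennreal_tendsto_0_add:
  fixes a b :: "nat \<Rightarrow> ennreal"
  assumes "a \<longlonglongrightarrow> 0" "b \<longlonglongrightarrow> 0" "\<And>n. c n \<le> ennreal A * a n + ennreal B * b n"
  shows "c \<longlonglongrightarrow> 0"
proof -
  have "(\<lambda>n. ennreal A * a n + ennreal B * b n) \<longlonglongrightarrow> ennreal A * 0 + ennreal B * 0"
    by (intro tendsto_add ennreal_tendsto_cmult assms) auto
  then show ?thesis
    by (intro tendsto_sandwich[of "\<lambda>_. 0" c sequentially "\<lambda>n. ennreal A * a n + ennreal B * b n"])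
       (use assms(3) in auto)
qed

text \<open>Existence of the continuous extension at the single point \<open>x\<close>. The bound is
  put on differences \<open>T f - T g\<close>, so it contains what is used of the linearity of
  \<open>T\<close>. The limit is built from one sequence \<open>xs0\<close>; any other approximating
  sequence stays close to \<open>xs0\<close>, hence has the same limit, as \<open>is_FP\<close> and
  \<open>is_U\<close> require.\<close>

lemma bounded_extension:
  fixes T :: "('a \<Rightarrow> complex) \<Rightarrow> ('b \<Rightarrow> complex)"
  assumes x [measurable]: "x \<in> borel_measurable M"
    and D: "\<And>f. D f \<Longrightarrow> f \<in> borel_measurable M"
    and T: "\<And>f. D f \<Longrightarrow> T f \<in> borel_measurable N"
    and fin: "\<And>f. D f \<Longrightarrow> sq_norm N (T f) < \<infinity>"
    and bd: "\<And>f g. D f \<Longrightarrow> D g \<Longrightarrow> sq_norm N (\<lambda>t. T f t - T g t) \<le> sq_norm M (\<lambda>t. f t - g t)"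
    and xs0: "\<And>n. D (xs0 n)" "sq_conv M xs0 x"
  shows "\<exists>y. y \<in> borel_measurable N \<and> sq_norm N y < \<infinity> \<and>
     (\<forall>xs. (\<forall>n. D (xs n)) \<longrightarrow> sq_conv M xs x \<longrightarrow> sq_conv N (\<lambda>n. T (xs n)) y)"
proof -
  have xm [measurable]: "xs0 n \<in> borel_measurable M" "T (xs0 n) \<in> borel_measurable N" for n
    using D T xs0 by auto
  have "\<exists>y\<in>borel_measurable N. sq_conv N (\<lambda>n. T (xs0 n)) y"
  proof (rule sq_norm_complete)
    fix e :: ennreal assume "e > 0"
    then obtain e' where e': "0 < e'" "e' < e" using dense by blast
    then have e'_top: "e' < top"
      using order.strict_trans2[OF e'(2) top_greatest] by simp
    from e' have "e' / 4 > 0" by (simp add: ennreal_zero_less_divide)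
    \<comment> \<open>The quarter offsets the factor 2 in \<open>sq_norm_triangle\<close> and the
      sum of two such terms.\<close>
    then obtain N' where N': "\<And>n. n \<ge> N' \<Longrightarrow> sq_norm M (\<lambda>t. xs0 n t - x t) < e' / 4"
      using order_tendstoD(2)[OF xs0(2)[unfolded sq_conv_def]] unfolding eventually_sequentially by blast
    have "sq_norm N (\<lambda>x. T (xs0 m) x - T (xs0 n) x) < e" if "m \<ge> N'" "n \<ge> N'" for m n
    proof -
      have "sq_norm N (\<lambda>x. T (xs0 m) x - T (xs0 n) x) \<le> sq_norm M (\<lambda>t. xs0 m t - xs0 n t)"
        by (intro bd xs0)
      also have "\<dots> \<le> 2 * sq_norm M (\<lambda>t. xs0 m t - x t) + 2 * sq_norm M (\<lambda>t. x t - xs0 n t)"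
        by (rule sq_norm_triangle) auto
      also have "sq_norm M (\<lambda>t. x t - xs0 n t) = sq_norm M (\<lambda>t. xs0 n t - x t)"
        by (rule sq_norm_commute)
      also have "2 * sq_norm M (\<lambda>t. xs0 m t - x t) + 2 * \<dots> \<le> 2 * (e'/4) + 2 * (e'/4)"
        by (intro add_mono mult_left_mono less_imp_le[OF N'] that) auto
      also have "\<dots> = e'"
      proof (cases e')
        case (real r)
        have "e' / 4 = ennreal (r / 4)"
          using real divide_ennreal[of r 4] by simp
        moreover have "2 * ennreal (r / 4) = ennreal (r / 2)"
          using real ennreal_mult[of 2 "r / 4"] by simp
        ultimately have "2 * (e'/4) + 2 * (e'/4) = ennreal (r / 2) + ennreal (r / 2)"
          by simp
        also have "\<dots> = ennreal (r / 2 + r / 2)"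
          using real by (intro ennreal_plus[symmetric]) auto
        finally show ?thesis using real by simp
      qed (use e'_top in auto)
      finally show ?thesis using e' by simp
    qed
    then show "\<exists>N'. \<forall>m\<ge>N'. \<forall>n\<ge>N'. sq_norm N (\<lambda>x. T (xs0 m) x - T (xs0 n) x) < e"
      by blast
  qed auto
  then obtain y where y [measurable]: "y \<in> borel_measurable N" and yc: "sq_conv N (\<lambda>n. T (xs0 n)) y"
    by blast
  have "sq_norm N y < \<infinity>"
  proof -
    have "eventually (\<lambda>n. sq_norm N (\<lambda>t. T (xs0 n) t - y t) < 1) sequentially"
      using yc unfolding sq_conv_def by (rule order_tendstoD) simp
    then obtain n where n: "sq_norm N (\<lambda>t. T (xs0 n) t - y t) < 1"
      unfolding eventually_sequentially by blast
    have "sq_norm N y = sq_norm N (\<lambda>t. (y t - T (xs0 n) t) + T (xs0 n) t)"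
      by simp
    also have "\<dots> \<le> 2 * sq_norm N (\<lambda>t. y t - T (xs0 n) t) + 2 * sq_norm N (T (xs0 n))"
      by (rule sq_norm_add_le) auto
    also have "\<dots> < \<infinity>"
      using order.strict_trans[OF n ennreal_one_less_top] fin[OF xs0(1)[of n]]
      by (simp add: sq_norm_commute[of N y] ennreal_mult_less_top)
    finally show ?thesis .
  qed
  moreover have "sq_conv N (\<lambda>n. T (xs n)) y" if xs: "\<forall>n. D (xs n)" "sq_conv M xs x" for xs
  proof -
    have xm' [measurable]: "xs n \<in> borel_measurable M" "T (xs n) \<in> borel_measurable N" for n
      using D T xs by auto
    have 1: "(\<lambda>n. sq_norm M (\<lambda>t. xs n t - xs0 n t)) \<longlonglongrightarrow> 0"
    proof (rule ennreal_tendsto_0_add[OF xs(2)[unfolded sq_conv_def] xs0(2)[unfolded sq_conv_def]])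
      fix n
      show "sq_norm M (\<lambda>t. xs n t - xs0 n t) \<le> ennreal 2 * sq_norm M (\<lambda>t. xs n t - x t) + ennreal 2 * sq_norm M (\<lambda>t. xs0 n t - x t)"
        using sq_norm_triangle[of "xs n" M x "xs0 n"] by (simp add: sq_norm_commute[of M x "xs0 n"])
    qed
    show ?thesis
      unfolding sq_conv_def
    proof (rule ennreal_tendsto_0_add[OF 1 yc[unfolded sq_conv_def]])
      fix n
      have "sq_norm N (\<lambda>t. T (xs n) t - y t) \<le> 2 * sq_norm N (\<lambda>t. T (xs n) t - T (xs0 n) t) + 2 * sq_norm N (\<lambda>t. T (xs0 n) t - y t)"
        by (rule sq_norm_triangle) auto
      also have "\<dots> \<le> 2 * sq_norm M (\<lambda>t. xs n t - xs0 n t) + 2 * sq_norm N (\<lambda>t. T (xs0 n) t - y t)"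
        using xs xs0 by (intro add_right_mono mult_left_mono bd) auto
      finally show "sq_norm N (\<lambda>t. T (xs n) t - y t) \<le> ennreal 2 * sq_norm M (\<lambda>t. xs n t - xs0 n t) + ennreal 2 * sq_norm N (\<lambda>t. T (xs0 n) t - y t)"
        by simp
    qed
  qed
  ultimately show ?thesis using y by blast
qed

section \<open>The Mellin transform of the damped exponential\<close>

lemma laplace_integrable:
  fixes k :: "real \<Rightarrow> complex"
  assumes [measurable]: "k \<in> borel_measurable borel"
    and int: "\<And>\<delta>. \<delta> > 0 \<Longrightarrow> integrable lborel (\<lambda>t. cmod (k t) * exp (- \<delta> * t))"
    and z: "Re z > 0"
  shows "integrable lborel (\<lambda>t. k t * exp (- z * complex_of_real t))"
  by (rule Bochner_Integration.integrable_bound[OF int[OF z]]) (auto simp: norm_mult)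

text \<open>Differentiation under the integral sign. Near \<open>z\<close> the difference quotient
  of the exponential is at most t exp (- \<delta> t / 2) by the mean value inequality, and part of
  this decay is spent on absorbing the factor t.\<close>

lemma laplace_holomorphic:
  fixes k :: "real \<Rightarrow> complex"
  assumes k [measurable]: "k \<in> borel_measurable borel" and k0: "\<And>t. t \<le> 0 \<Longrightarrow> k t = 0"
    and int: "\<And>\<delta>. \<delta> > 0 \<Longrightarrow> integrable lborel (\<lambda>t. cmod (k t) * exp (- \<delta> * t))"
  shows "(\<lambda>z. LINT t|lborel. k t * exp (- z * complex_of_real t)) holomorphic_on {z. Re z > 0}"
proof -
  define L where "L = (\<lambda>z. LINT t|lborel. k t * exp (- z * complex_of_real t))"
  have "\<exists>D. (L has_field_derivative D) (at z)" if z: "Re z > 0" for z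
  proof -
    define \<delta> where "\<delta> = Re z"
    \<comment> \<open>Half the distance to the imaginary axis keeps \<open>Re w\<close> above
      \<open>\<delta> / 2\<close> on the whole ball, and the ball is convex, as the mean value
      inequality requires.\<close>
    define B where "B = ball z (\<delta> / 2)"
    have \<delta>: "\<delta> > 0" using z by (simp add: \<delta>_def)
    have zB: "z \<in> B" using \<delta> by (simp add: B_def)
    have Re_B: "Re w > \<delta> / 2" if "w \<in> B" for w
      using that abs_Re_le_cmod[of "z - w"] by (auto simp: B_def \<delta>_def dist_norm)
    define D where "D = (LINT t|lborel. k t * (- complex_of_real t * exp (- z * complex_of_real t)))"
    have der: "((\<lambda>w. exp (- w * complex_of_real t)) has_field_derivative
        - complex_of_real t * exp (- w * complex_of_real t)) (at w within B)" for w t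
      by (auto intro!: derivative_eq_intros)
    have "((\<lambda>w. (L w - L z) / (w - z)) \<longlongrightarrow> D) (at z within B)"
      unfolding tendsto_at_iff_sequentially
    proof (intro allI impI)
      \<comment> \<open>Dominated convergence speaks of sequences, so the limit of the quotient is
        tested along an arbitrary sequence.\<close>
      fix X :: "nat \<Rightarrow> complex" assume X: "\<forall>i. X i \<in> B - {z}" and Xz: "X \<longlonglongrightarrow> z"
      have *: "((\<lambda>w. (L w - L z) / (w - z)) \<circ> X) =
         (\<lambda>n. LINT t|lborel. k t * ((exp (- X n * complex_of_real t) - exp (- z * complex_of_real t)) / (X n - z)))"
      proof
        fix n
        have "Re (X n) > 0" using Re_B[of "X n"] X \<delta> by force
        then have "L (X n) - L z = (LINT t|lborel. k t * exp (- X n * complex_of_real t) - k t * exp (- z * complex_of_real t))"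
          unfolding L_def
          by (intro Bochner_Integration.integral_diff[symmetric] laplace_integrable k int z) auto
        also have "\<dots> / (X n - z) = (LINT t|lborel. (k t * exp (- X n * complex_of_real t) - k t * exp (- z * complex_of_real t)) / (X n - z))"
          by (rule integral_divide_zero[symmetric])
        finally show "((\<lambda>w. (L w - L z) / (w - z)) \<circ> X) n = (LINT t|lborel. k t * ((exp (- X n * complex_of_real t) - exp (- z * complex_of_real t)) / (X n - z)))"
          by (simp add: right_diff_distrib diff_divide_distrib)
      qed
      show "((\<lambda>w. (L w - L z) / (w - z)) \<circ> X) \<longlonglongrightarrow> D"
        unfolding * D_def
      proof (rule integral_dominated_convergence)
        show "integrable lborel (\<lambda>t. (4 / \<delta>) * (cmod (k t) * exp (- (\<delta> / 4) * t)))"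
          using \<delta> by (intro integrable_mult_right int) auto
        show "AE t in lborel. (\<lambda>n. k t * ((exp (- X n * complex_of_real t) - exp (- z * complex_of_real t)) / (X n - z)))
           \<longlonglongrightarrow> k t * (- complex_of_real t * exp (- z * complex_of_real t))"
        proof (intro AE_I2 tendsto_mult_left)
          fix t
          show "(\<lambda>n. (exp (- X n * complex_of_real t) - exp (- z * complex_of_real t)) / (X n - z))
             \<longlonglongrightarrow> - complex_of_real t * exp (- z * complex_of_real t)"
            using der[of t z] X Xz
            unfolding has_field_derivative_iff tendsto_at_iff_sequentially o_def by blast
        qed
        fix n
        show "AE t in lborel. cmod (k t * ((exp (- X n * complex_of_real t) - exp (- z * complex_of_real t)) / (X n - z)))
           \<le> (4 / \<delta>) * (cmod (k t) * exp (- (\<delta> / 4) * t))"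
        proof (rule AE_I2)
          fix t
          show "cmod (k t * ((exp (- X n * complex_of_real t) - exp (- z * complex_of_real t)) / (X n - z)))
             \<le> (4 / \<delta>) * (cmod (k t) * exp (- (\<delta> / 4) * t))"
          proof (cases "t \<le> 0")
            case False
            then have t: "t > 0" by simp
            have "cmod (exp (- X n * complex_of_real t) - exp (- z * complex_of_real t)) \<le> (t * exp (- (\<delta> / 2) * t)) * cmod (X n - z)"
            proof (rule field_differentiable_bound[OF _ der])
              fix w assume "w \<in> B"
              then show "cmod (- complex_of_real t * exp (- w * complex_of_real t)) \<le> t * exp (- (\<delta> / 2) * t)"
                using t Re_B[of w] by (auto simp: norm_mult mult_right_mono)
            qed (use X zB in \<open>auto simp: B_def\<close>)
            also have "t * exp (- (\<delta> / 2) * t) \<le> (4 / \<delta>) * exp (- (\<delta> / 4) * t)"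
            proof -
              \<comment> \<open>u \<le> exp u at u = \<delta> t / 4: bounding the factor t costs
                \<delta>/4 of the exponent and leaves \<delta>/4.\<close>
              have "\<delta> / 4 * t \<le> exp (\<delta> / 4 * t)"
                using exp_ge_add_one_self[of "\<delta> / 4 * t"] by linarith
              then have "t \<le> (4 / \<delta>) * exp (\<delta> / 4 * t)"
                using \<delta> by (simp add: field_simps)
              then have "t * exp (- (\<delta> / 2) * t) \<le> (4 / \<delta>) * exp (\<delta> / 4 * t) * exp (- (\<delta> / 2) * t)"
                by (intro mult_right_mono) auto
              also have "\<dots> = (4 / \<delta>) * exp (- (\<delta> / 4) * t)"
                by (simp add: mult.assoc flip: exp_add)
              finally show ?thesis .
            qed
            finally have "cmod (exp (- X n * complex_of_real t) - exp (- z * complex_of_real t)) / cmod (X n - z)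
                \<le> (4 / \<delta>) * exp (- (\<delta> / 4) * t)"
              using X by (simp add: pos_divide_le_eq mult_right_mono)
            then have "cmod (k t) * (cmod (exp (- X n * complex_of_real t) - exp (- z * complex_of_real t)) / cmod (X n - z))
                \<le> cmod (k t) * ((4 / \<delta>) * exp (- (\<delta> / 4) * t))"
              by (rule mult_left_mono) simp
            then show ?thesis
              by (simp add: norm_mult norm_divide mult_ac)
          qed (simp add: k0)
        qed
      qed measurable
    qed
    then have "(L has_field_derivative D) (at z within B)"
      by (simp add: has_field_derivative_iff)
    then have "(L has_field_derivative D) (at z)"
      by (simp only: at_within_open[OF zB, unfolded B_def, OF open_ball] B_def)
    then show ?thesis by blast
  qed
  then have "L holomorphic_on {z. Re z > 0}"
    by (intro holomorphic_onI) (auto simp: field_differentiable_def intro: has_field_derivative_at_within)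
  then show ?thesis by (simp add: L_def)
qed

text \<open>\<open>t powr (s - 1)\<close> on the critical line s = 1/2 + i \<nu>, extended by zero
  so that Fubini and affine substitution on the whole of \<open>lborel\<close> apply to it.\<close>

definition mellin_kernel :: "real \<Rightarrow> real \<Rightarrow> complex" where
  "mellin_kernel \<nu> t = indicator {0<..} t *\<^sub>R
     (complex_of_real (t powr (-1/2)) * exp (\<i> * complex_of_real (\<nu> * ln t)))"

lemma mellin_kernel_measurable [measurable]: "mellin_kernel \<nu> \<in> borel_measurable borel"
  unfolding mellin_kernel_def by measurable

lemma mellin_kernel_nonpos: "t \<le> 0 \<Longrightarrow> mellin_kernel \<nu> t = 0"
  by (simp add: mellin_kernel_def)

lemma norm_mellin_kernel: "t > 0 \<Longrightarrow> cmod (mellin_kernel \<nu> t) = t powr (-1/2)"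
  by (simp add: mellin_kernel_def norm_mult)

lemma mellin_kernel_eq_powr:
  "t > 0 \<Longrightarrow> mellin_kernel \<nu> t = complex_of_real t powr ((1/2 + \<i> * complex_of_real \<nu>) - 1)"
  by (simp add: mellin_kernel_def powr_def Ln_of_real exp_of_real[symmetric] exp_add[symmetric] algebra_simps)

lemma mellin_kernel_scale:
  assumes "r > 0" "t > 0"
  shows "mellin_kernel \<nu> (r * t) = mellin_kernel \<nu> r * mellin_kernel \<nu> t"
  using assms by (simp add: mellin_kernel_def powr_mult ln_mult exp_add[symmetric] algebra_simps)

text \<open>Absolute convergence of the Gamma integral at real part 1/2, moved from
  \<open>lebesgue\<close> to \<open>lborel\<close>; the integrand is Borel, so the two notions
  agree.\<close>

lemma mellin_kernel_integrable:
  assumes a: "a > 0"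
  shows "integrable lborel (\<lambda>t. cmod (mellin_kernel \<nu> t) * exp (- a * t))"
proof -
  have "(\<lambda>t. complex_of_real t powr ((1/2 + \<i> * complex_of_real \<nu>) - 1) / of_real (exp (a * t))) absolutely_integrable_on {0<..}"
    using a by (intro absolutely_integrable_Gamma_integral) auto
  then have "integrable lebesgue (\<lambda>t. cmod (indicator {0<..} t *\<^sub>R (complex_of_real t powr ((1/2 + \<i> * complex_of_real \<nu>) - 1) / of_real (exp (a * t)))))"
    unfolding set_integrable_def by (rule integrable_norm)
  also have "(\<lambda>t. cmod (indicator {0<..} t *\<^sub>R (complex_of_real t powr ((1/2 + \<i> * complex_of_real \<nu>) - 1) / of_real (exp (a * t)))))
     = (\<lambda>t. cmod (mellin_kernel \<nu> t) * exp (- a * t))"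
  proof
    fix t
    show "cmod (indicator {0<..} t *\<^sub>R (complex_of_real t powr ((1/2 + \<i> * complex_of_real \<nu>) - 1) / of_real (exp (a * t))))
       = cmod (mellin_kernel \<nu> t) * exp (- a * t)"
      by (cases "t > 0")
         (simp_all add: mellin_kernel_nonpos mellin_kernel_eq_powr norm_divide exp_minus field_simps)
  qed
  finally show ?thesis
    by (subst (asm) integrable_completion) auto
qed

lemma mellin_gamma_1:
  "(LINT t|lborel. mellin_kernel \<nu> t * exp (- complex_of_real t)) = Gamma (1/2 + \<i> * complex_of_real \<nu>)"
proof -
  define F where "F = (\<lambda>t. complex_of_real t powr ((1/2 + \<i> * complex_of_real \<nu>) - 1) / of_real (exp t))"
  have eq: "indicator {0<..} t *\<^sub>R F t = mellin_kernel \<nu> t * exp (- 1 * complex_of_real t)" for t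
  proof (cases "t > 0")
    case True
    have "exp (- 1 * complex_of_real t) = inverse (complex_of_real (exp t))"
      by (simp add: exp_minus exp_of_real)
    with True show ?thesis
      by (simp only: mellin_kernel_eq_powr F_def divide_inverse) simp
  qed (simp add: mellin_kernel_nonpos)
  have "set_integrable lborel {0<..} F"
    unfolding set_integrable_def eq
    by (rule laplace_integrable) (auto simp: mellin_kernel_nonpos intro: mellin_kernel_integrable[simplified])
  then have "(LINT t:{0<..}|lborel. F t) = integral {0<..} F"
    by (rule set_borel_integral_eq_integral)
  also have "\<dots> = Gamma (1/2 + \<i> * complex_of_real \<nu>)"
    unfolding F_def by (intro integral_unique Gamma_integral_complex') simp
  finally show ?thesis
    unfolding set_lebesgue_integral_def eq by simp
qed

text \<open>On the positive axis the formula is a rescaling of the Gamma integral. Both sides are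
  holomorphic in the right half-plane, so the identity theorem extends it to complex
  \<open>z\<close>, where a direct substitution would have to rotate the contour.\<close>

lemma mellin_gamma:
  assumes "Re z > 0"
  shows "(LINT t|lborel. mellin_kernel \<nu> t * exp (- z * complex_of_real t))
     = Gamma (1/2 + \<i> * complex_of_real \<nu>) * z powr (- (1/2 + \<i> * complex_of_real \<nu>))"
proof -
  define s where "s = 1/2 + \<i> * complex_of_real \<nu>"
  define L where "L = (\<lambda>z. LINT t|lborel. mellin_kernel \<nu> t * exp (- z * complex_of_real t))"
  define H where "H = {z :: complex. Re z > 0}"
  have "L holomorphic_on H"
    unfolding L_def H_def
    by (rule laplace_holomorphic) (auto simp: mellin_kernel_nonpos intro: mellin_kernel_integrable[simplified])
  then have hol: "(\<lambda>z. L z - Gamma s * z powr (- s)) holomorphic_on H"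
    by (intro holomorphic_intros) (auto simp: H_def complex_nonpos_Reals_iff)
  have "L z - Gamma s * z powr (- s) = 0"
  proof (rule analytic_continuation[OF hol])
    show "open H" by (simp add: H_def open_halfspace_Re_gt)
    show "connected H" by (simp add: H_def convex_connected convex_halfspace_Re_gt)
    show "complex_of_real ` {0<..} \<subseteq> H" "1 \<in> H" "z \<in> H"
      using assms by (auto simp: H_def)
    have "(1::real) islimpt {0<..}"
      by (rule interior_limit_point) (simp add: interior_open)
    then have "complex_of_real 1 islimpt complex_of_real ` {0<..}"
      by (rule islimpt_isCont_image) (auto simp: eventually_at_filter)
    then show "1 islimpt complex_of_real ` {0<..}" by simp
    fix w assume "w \<in> complex_of_real ` {0<..}"
    then obtain r where r: "r > 0" "w = complex_of_real r" by auto
    have "Gamma s = (LINT t|lborel. mellin_kernel \<nu> t * exp (- complex_of_real t))"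
      by (simp add: mellin_gamma_1 s_def)
    also have "\<dots> = r *\<^sub>R (LINT t|lborel. mellin_kernel \<nu> (0 + r * t) * exp (- complex_of_real (0 + r * t)))"
      using r by (subst lborel_integral_real_affine[where c=r and t=0]) auto
    also have "(LINT t|lborel. mellin_kernel \<nu> (0 + r * t) * exp (- complex_of_real (0 + r * t)))
       = (LINT t|lborel. mellin_kernel \<nu> r * (mellin_kernel \<nu> t * exp (- w * complex_of_real t)))"
    proof (rule Bochner_Integration.integral_cong[OF refl])
      fix t
      show "mellin_kernel \<nu> (0 + r * t) * exp (- complex_of_real (0 + r * t)) = mellin_kernel \<nu> r * (mellin_kernel \<nu> t * exp (- w * complex_of_real t))"
        using r mellin_kernel_scale[of r t \<nu>]
        by (cases "t > 0") (simp_all add: mellin_kernel_nonpos mult_nonneg_nonpos)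
    qed
    also have "\<dots> = mellin_kernel \<nu> r * L w"
      by (simp add: L_def)
    \<comment> \<open>The Jacobian \<open>r\<close> raises the exponent \<open>s - 1\<close> of the
      scaled kernel to \<open>s\<close>.\<close>
    also have "r *\<^sub>R (mellin_kernel \<nu> r * L w) = (w * w powr (s - 1)) * L w"
      using r by (simp add: scaleR_conv_of_real mellin_kernel_eq_powr s_def)
    also have "w * w powr (s - 1) = w powr s"
      using r powr_add[of w 1 "s - 1"] by simp
    finally have "Gamma s = w powr s * L w" .
    then show "L w - Gamma s * w powr (- s) = 0"
      using r by (simp add: powr_minus field_simps)
  qed
  then show ?thesis by (simp add: L_def s_def)
qed

section \<open>Functions on the half-line and the operator F\<close>

text \<open>The abstract mean square lemmas are applied on this measure space, while Fourier
  integrals and Fubini live on the whole line; \<open>zext\<close> passes from one to the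
  other.\<close>

definition half_line :: "real measure" where
  "half_line = restrict_space lborel {0<..}"

definition zext :: "(real \<Rightarrow> complex) \<Rightarrow> real \<Rightarrow> complex" where
  "zext f t = indicator {0<..} t *\<^sub>R f t"

lemma space_half_line [simp]: "space half_line = {0<..}"
  by (simp add: half_line_def space_restrict_space)

lemma measurable_half_lineI: "f \<in> borel_measurable borel \<Longrightarrow> f \<in> borel_measurable half_line"
  unfolding half_line_def by (rule measurable_restrict_space1) simp

lemma measurable_half_line_iff: "f \<in> borel_measurable half_line \<longleftrightarrow> zext f \<in> borel_measurable borel"
  unfolding half_line_def zext_def[abs_def]
  by (subst borel_measurable_restrict_space_iff) auto

lemma nn_integral_half_line: "(\<integral>\<^sup>+t. f t \<partial>half_line) = (\<integral>\<^sup>+t. f t * indicator {0<..} t \<partial>lborel)"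
  unfolding half_line_def by (rule nn_integral_restrict_space) simp

lemma sq_norm_half_line: "sq_norm half_line f = (\<integral>\<^sup>+t. ennreal ((cmod (zext f t))\<^sup>2) \<partial>lborel)"
  unfolding sq_norm_def nn_integral_half_line
  by (intro nn_integral_cong) (simp add: zext_def indicator_def)

lemma set_integrable_zext: "set_integrable lborel {0<..} f \<longleftrightarrow> integrable lborel (zext f)"
  by (simp add: set_integrable_def zext_def[abs_def])

lemma sq_norm_finite_iff:
  assumes "f \<in> borel_measurable half_line"
  shows "set_integrable lborel {0<..} (\<lambda>t. (cmod (f t))\<^sup>2) \<longleftrightarrow> sq_norm half_line f < \<infinity>"
proof -
  have [measurable]: "zext f \<in> borel_measurable borel"
    using assms by (simp add: measurable_half_line_iff)
  have "set_integrable lborel {0<..} (\<lambda>t. (cmod (f t))\<^sup>2) \<longleftrightarrow> integrable lborel (\<lambda>t. (cmod (zext f t))\<^sup>2)"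
    unfolding set_integrable_def zext_def
    by (rule arg_cong[where f="integrable lborel"]) (auto simp: fun_eq_iff indicator_def)
  also have "\<dots> \<longleftrightarrow> sq_norm half_line f < \<infinity>"
    unfolding sq_norm_half_line by (subst integrable_iff_bounded) simp
  finally show ?thesis .
qed

lemma L2pos_iff: "L2pos f \<longleftrightarrow> f \<in> borel_measurable half_line \<and> sq_norm half_line f < \<infinity>"
  unfolding L2pos_def
  by (auto simp: sq_norm_finite_iff set_borel_measurable_def measurable_half_line_iff zext_def[abs_def])

lemma sq_norm_diff_finite:
  assumes "L2pos f" "L2pos g"
  shows "sq_norm half_line (\<lambda>t. f t - g t) < \<infinity>"
proof -
  have "sq_norm half_line (\<lambda>t. f t + - g t) \<le> 2 * sq_norm half_line f + 2 * sq_norm half_line (\<lambda>t. - g t)"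
    using assms by (intro sq_norm_add_le) (auto simp: L2pos_iff)
  also have "\<dots> < \<infinity>"
    using assms by (simp add: L2pos_iff ennreal_mult_less_top sq_norm_def)
  finally show ?thesis by simp
qed

text \<open>\<open>L2dist\<close> is a Bochner integral, which would report 0 for a difference that
  is not square integrable. For \<open>L2pos\<close> arguments this cannot happen, and the two
  distances agree.\<close>

lemma L2dist_sq:
  assumes "L2pos f" "L2pos g"
  shows "ennreal ((L2dist f g)\<^sup>2) = sq_norm half_line (\<lambda>t. f t - g t)"
proof -
  have m: "(\<lambda>t. f t - g t) \<in> borel_measurable half_line"
    using assms by (auto simp: L2pos_iff)
  have i: "set_integrable lborel {0<..} (\<lambda>t. (cmod (f t - g t))\<^sup>2)"
    using sq_norm_diff_finite[OF assms] by (simp add: sq_norm_finite_iff[OF m])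
  have "(L2dist f g)\<^sup>2 = (LINT t:{0<..}|lborel. (cmod (f t - g t))\<^sup>2)"
    unfolding L2dist_def set_lebesgue_integral_def
    by (intro real_sqrt_pow2 integral_nonneg_AE) auto
  then have "ennreal ((L2dist f g)\<^sup>2) = (\<integral>\<^sup>+t. ennreal (indicator {0<..} t *\<^sub>R (cmod (f t - g t))\<^sup>2) \<partial>lborel)"
    using i unfolding set_integrable_def set_lebesgue_integral_def
    by (subst nn_integral_eq_integral) auto
  also have "\<dots> = sq_norm half_line (\<lambda>t. f t - g t)"
    unfolding sq_norm_def nn_integral_half_line by (intro nn_integral_cong) (simp add: indicator_def)
  finally show ?thesis .
qed

lemma L2conv_iff:
  assumes "\<And>n. L2pos (xs n)" "L2pos x"
  shows "L2conv xs x \<longleftrightarrow> sq_conv half_line xs x"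
proof -
  have "L2dist f g \<ge> 0" for f g
    unfolding L2dist_def set_lebesgue_integral_def by (simp add: integral_nonneg_AE)
  then have "L2conv xs x \<longleftrightarrow> (\<lambda>n. (L2dist (xs n) x)\<^sup>2) \<longlonglongrightarrow> 0"
    unfolding L2conv_def using tendsto_power[of "\<lambda>n. L2dist (xs n) x" 0 sequentially 2]
      tendsto_real_sqrt[of "\<lambda>n. (L2dist (xs n) x)\<^sup>2" 0 sequentially] by auto
  also have "\<dots> \<longleftrightarrow> (\<lambda>n. ennreal ((L2dist (xs n) x)\<^sup>2)) \<longlonglongrightarrow> ennreal 0"
    by (intro tendsto_ennreal_iff[symmetric]) auto
  also have "\<dots> \<longleftrightarrow> sq_conv half_line xs x"
    using assms by (simp add: L2dist_sq sq_conv_def)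
  finally show ?thesis .
qed

section \<open>The truncated Fourier integral as a contraction\<close>

lemma FP_domD:
  assumes "FP_dom x"
  shows "x \<in> borel_measurable half_line" "sq_norm half_line x < \<infinity>" "integrable lborel (zext x)" "zext x \<in> borel_measurable borel"
  using assms by (auto simp: FP_dom_def L2pos_iff set_integrable_zext measurable_half_line_iff)

lemma FPint_eq_fourier: "FPint x t = complex_of_real (1 / sqrt (2*pi)) * fourier (zext x) t"
  by (simp add: FPint_def fourier_def set_lebesgue_integral_def zext_def)

lemma FPint_measurable [measurable (raw)]: "FP_dom x \<Longrightarrow> FPint x \<in> borel_measurable borel"
  unfolding FPint_eq_fourier[abs_def] using FP_domD(4)[of x] by simp

lemma plancherel_normalized:
  assumes "integrable lborel h"
  shows "(\<integral>\<^sup>+t. ennreal ((cmod (complex_of_real (1 / sqrt (2*pi)) * fourier h t))\<^sup>2) \<partial>lborel)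
     \<le> (\<integral>\<^sup>+x. ennreal ((cmod (h x))\<^sup>2) \<partial>lborel)"
proof -
  have [measurable]: "h \<in> borel_measurable borel" using assms by auto
  have "(\<integral>\<^sup>+t. ennreal ((cmod (complex_of_real (1 / sqrt (2*pi)) * fourier h t))\<^sup>2) \<partial>lborel)
     = (\<integral>\<^sup>+t. ennreal (1 / (2*pi)) * ennreal ((cmod (fourier h t))\<^sup>2) \<partial>lborel)"
    by (intro nn_integral_cong)
       (simp add: norm_mult norm_divide power_mult_distrib power_divide ennreal_mult[symmetric])
  also have "\<dots> = ennreal (1 / (2*pi)) * (\<integral>\<^sup>+t. ennreal ((cmod (fourier h t))\<^sup>2) \<partial>lborel)"
    by (simp add: nn_integral_cmult)
  also have "\<dots> \<le> ennreal (1 / (2*pi)) * (ennreal (2 * pi) * (\<integral>\<^sup>+x. ennreal ((cmod (h x))\<^sup>2) \<partial>lborel))"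
    by (intro mult_left_mono plancherel_le assms) simp
  also have "\<dots> = (\<integral>\<^sup>+x. ennreal ((cmod (h x))\<^sup>2) \<partial>lborel)"
    by (simp add: mult.assoc[symmetric] ennreal_mult[symmetric])
  finally show ?thesis .
qed

lemma sq_norm_half_line_le: "sq_norm half_line f \<le> (\<integral>\<^sup>+t. ennreal ((cmod (f t))\<^sup>2) \<partial>lborel)"
  unfolding sq_norm_half_line by (intro nn_integral_mono) (simp add: zext_def indicator_def)

text \<open>Extension by zero preserves the norm, Plancherel does not increase it, and restricting
  the transform to positive arguments can only lose mass.\<close>

lemma FPint_bound:
  assumes "FP_dom f" "FP_dom g"
  shows "sq_norm half_line (\<lambda>t. FPint f t - FPint g t) \<le> sq_norm half_line (\<lambda>t. f t - g t)"
proof -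
  have eq: "(\<lambda>t. FPint f t - FPint g t) = (\<lambda>t. complex_of_real (1 / sqrt (2*pi)) * fourier (\<lambda>x. zext f x - zext g x) t)"
    using assms by (simp add: FPint_eq_fourier fourier_diff FP_domD right_diff_distrib)
  have "sq_norm half_line (\<lambda>t. FPint f t - FPint g t)
     \<le> (\<integral>\<^sup>+t. ennreal ((cmod (complex_of_real (1 / sqrt (2*pi)) * fourier (\<lambda>x. zext f x - zext g x) t))\<^sup>2) \<partial>lborel)"
    unfolding eq by (rule sq_norm_half_line_le)
  also have "\<dots> \<le> (\<integral>\<^sup>+x. ennreal ((cmod (zext f x - zext g x))\<^sup>2) \<partial>lborel)"
    using assms by (intro plancherel_normalized) (auto intro: FP_domD)
  also have "\<dots> = sq_norm half_line (\<lambda>t. f t - g t)"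
    unfolding sq_norm_half_line by (simp add: zext_def scaleR_diff_right)
  finally show ?thesis .
qed

lemma FPint_zero: "FPint (\<lambda>_. 0) = (\<lambda>_. 0)"
  by (simp add: FPint_def set_lebesgue_integral_def fun_eq_iff)

lemma FPint_finite: "FP_dom f \<Longrightarrow> sq_norm half_line (FPint f) < top"
proof -
  assume f: "FP_dom f"
  have "FP_dom (\<lambda>_. 0)"
    by (simp add: FP_dom_def L2pos_def set_borel_measurable_def set_integrable_def)
  from FPint_bound[OF f this] FP_domD(2)[OF f] show ?thesis
    by (simp add: FPint_zero)
qed

text \<open>Cutting off at infinity alone would give integrability but leave the singularity of
  \<xi> to the power -1/2 at 0. With both ends cut, one sequence lies in \<open>FP_dom\<close> and
  in \<open>U_dom\<close> at the same time.\<close>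

definition trunc :: "(real \<Rightarrow> complex) \<Rightarrow> nat \<Rightarrow> real \<Rightarrow> complex" where
  "trunc x n t = indicator {1 / real (Suc n)..real (Suc n)} t *\<^sub>R x t"

lemma zext_trunc: "zext (trunc x n) t = indicator {1 / real (Suc n)..real (Suc n)} t *\<^sub>R zext x t"
  by (simp add: zext_def trunc_def mult.commute)

lemma L2pos_trunc:
  assumes "L2pos x" shows "L2pos (trunc x n)"
proof -
  have [measurable]: "zext x \<in> borel_measurable borel"
    using assms by (simp add: L2pos_iff measurable_half_line_iff)
  have "zext (trunc x n) \<in> borel_measurable borel"
    unfolding zext_trunc[abs_def] by measurable
  moreover have "sq_norm half_line (trunc x n) \<le> sq_norm half_line x"
    unfolding sq_norm_def by (intro nn_integral_mono) (simp add: trunc_def indicator_def)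
  ultimately show ?thesis
    using assms by (auto simp: L2pos_iff measurable_half_line_iff)
qed

text \<open>On a bounded interval square integrability implies integrability, since c \<le> 1 + c *
  c. The weight 1 serves \<open>FP_dom\<close>, the weight \<open>t powr (-1/2)\<close> serves
  \<open>U_dom\<close>.\<close>

lemma integrable_weighted_trunc:
  assumes x: "L2pos x" and w [measurable]: "w \<in> borel_measurable borel"
    and bd: "\<And>t. 1 / real (Suc n) \<le> t \<Longrightarrow> t \<le> real (Suc n) \<Longrightarrow> \<bar>w t\<bar> \<le> C"
  shows "integrable lborel (\<lambda>t. w t * cmod (zext (trunc x n) t))"
proof -
  let ?I = "{1 / real (Suc n)..real (Suc n)}"
  have [measurable]: "zext x \<in> borel_measurable borel" "zext (trunc x n) \<in> borel_measurable borel"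
    using x L2pos_trunc[OF x] by (auto simp: L2pos_iff measurable_half_line_iff)
  \<comment> \<open>The point 1 lies in every truncation interval.\<close>
  have "C \<ge> 0"
    using bd[of 1] by (auto simp: field_simps intro: order_trans[OF abs_ge_zero])
  have 1: "integrable lborel (\<lambda>t. (cmod (zext x t))\<^sup>2)"
    using x unfolding L2pos_iff sq_norm_half_line by (intro integrableI_bounded) auto
  have "integrable lborel (\<lambda>t. C * (indicator ?I t + (cmod (zext x t))\<^sup>2))"
    by (intro integrable_mult_right Bochner_Integration.integrable_add 1 integrable_real_indicator emeasure_bounded_finite) auto
  then show ?thesis
  proof (rule Bochner_Integration.integrable_bound)
    show "AE t in lborel. norm (w t * cmod (zext (trunc x n) t)) \<le> norm (C * (indicator ?I t + (cmod (zext x t))\<^sup>2))"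
    proof (rule AE_I2)
      fix t
      show "norm (w t * cmod (zext (trunc x n) t)) \<le> norm (C * (indicator ?I t + (cmod (zext x t))\<^sup>2))"
      proof (cases "t \<in> ?I")
        case True
        have "2 * cmod (zext x t) \<le> 1 + (cmod (zext x t))\<^sup>2"
          using sum_squares_bound[of 1 "cmod (zext x t)"] by simp
        then have "cmod (zext x t) \<le> 1 + (cmod (zext x t))\<^sup>2"
          using norm_ge_zero[of "zext x t"] by linarith
        then have "\<bar>w t\<bar> * cmod (zext x t) \<le> C * (1 + (cmod (zext x t))\<^sup>2)"
          using True bd[of t] \<open>C \<ge> 0\<close> by (intro mult_mono) auto
        then show ?thesis
          using True \<open>C \<ge> 0\<close> by (simp add: zext_trunc abs_mult)
      qed (simp add: zext_trunc)
    qed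
  qed simp
qed

lemma FP_dom_trunc:
  assumes "L2pos x" shows "FP_dom (trunc x n)"
proof -
  have "zext (trunc x n) \<in> borel_measurable borel"
    using L2pos_trunc[OF assms] by (auto simp: L2pos_iff measurable_half_line_iff)
  moreover have "integrable lborel (\<lambda>t. cmod (zext (trunc x n) t))"
    using integrable_weighted_trunc[OF assms, of "\<lambda>_. 1" n 1] by simp
  ultimately have "integrable lborel (zext (trunc x n))"
    by (subst (asm) integrable_norm_iff) auto
  then show ?thesis
    using L2pos_trunc[OF assms] by (simp add: FP_dom_def set_integrable_zext)
qed

lemma U_dom_trunc:
  assumes "L2pos x" shows "U_dom (trunc x n)"
proof -
  have "t powr (- 1 / 2) \<le> real (Suc n) powr (1/2)" if "1 / real (Suc n) \<le> t" for t
  proof -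
    have "t powr (- 1 / 2) \<le> (1 / real (Suc n)) powr (- 1 / 2)"
      using that by (intro powr_mono2') auto
    then show ?thesis by (simp add: powr_divide powr_minus field_simps)
  qed
  then have "integrable lborel (\<lambda>t. t powr (-1/2) * cmod (zext (trunc x n) t))"
    using integrable_weighted_trunc[OF assms, of "\<lambda>t. t powr (-1/2)" n "real (Suc n) powr (1/2)"] by simp
  also have "(\<lambda>t. t powr (-1/2) * cmod (zext (trunc x n) t)) = (\<lambda>t. indicator {0<..} t *\<^sub>R (cmod (trunc x n t) * t powr (-1/2)))"
    by (auto simp: zext_def fun_eq_iff mult_ac)
  finally show ?thesis
    using L2pos_trunc[OF assms] by (simp add: U_dom_def set_integrable_def)
qed

lemma sq_conv_trunc:
  assumes x: "L2pos x" shows "sq_conv half_line (trunc x) x"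
proof -
  have [measurable]: "x \<in> borel_measurable half_line" "\<And>n. trunc x n \<in> borel_measurable half_line"
    using x L2pos_trunc[OF x] by (auto simp: L2pos_iff)
  have "(\<lambda>n. \<integral>\<^sup>+t. ennreal ((cmod (trunc x n t - x t))\<^sup>2) \<partial>half_line) \<longlonglongrightarrow> (\<integral>\<^sup>+t. 0 \<partial>half_line)"
  proof (rule nn_integral_dominated_convergence[where w="\<lambda>t. ennreal ((cmod (x t))\<^sup>2)"])
    show "(\<integral>\<^sup>+t. ennreal ((cmod (x t))\<^sup>2) \<partial>half_line) < \<infinity>"
      using x by (simp add: L2pos_iff sq_norm_def)
    show "AE t in half_line. ennreal ((cmod (trunc x n t - x t))\<^sup>2) \<le> ennreal ((cmod (x t))\<^sup>2)" for n
      by (rule AE_I2) (simp add: trunc_def indicator_def)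
    show "AE t in half_line. (\<lambda>n. ennreal ((cmod (trunc x n t - x t))\<^sup>2)) \<longlonglongrightarrow> 0"
    proof (rule AE_I2)
      fix t assume "t \<in> space half_line"
      then have t: "t > 0" by simp
      obtain N :: nat where N: "real N > max t (1 / t)"
        using reals_Archimedean2 by blast
      have "trunc x n t = x t" if "n \<ge> N" for n
      proof -
        have *: "real (Suc n) \<ge> t" "real (Suc n) \<ge> 1 / t" using N that by auto
        then have "1 / real (Suc n) \<le> t" using t by (simp add: field_simps)
        with * show ?thesis by (simp add: trunc_def)
      qed
      then show "(\<lambda>n. ennreal ((cmod (trunc x n t - x t))\<^sup>2)) \<longlonglongrightarrow> 0"
        by (intro tendsto_eventually) (auto simp: eventually_sequentially intro!: exI[of _ N])
    qed
  qed auto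
  then show ?thesis by (simp add: sq_conv_def sq_norm_def)
qed

section \<open>Extension of the transform to all square integrable functions\<close>

lemma is_FP_iff:
  assumes "L2pos x"
  shows "is_FP x y \<longleftrightarrow> L2pos y \<and>
     (\<forall>xs. (\<forall>n. FP_dom (xs n)) \<longrightarrow> sq_conv half_line xs x \<longrightarrow> sq_conv half_line (\<lambda>n. FPint (xs n)) y)"
proof -
  have 1: "L2conv xs x = sq_conv half_line xs x" if "\<forall>n. FP_dom (xs n)" for xs
    using that assms by (intro L2conv_iff) (auto simp: FP_dom_def)
  have 2: "L2conv (\<lambda>n. FPint (xs n)) y = sq_conv half_line (\<lambda>n. FPint (xs n)) y" if "\<forall>n. FP_dom (xs n)" "L2pos y" for xs
    using that by (intro L2conv_iff) (auto simp: L2pos_iff FPint_finite intro!: measurable_half_lineI FPint_measurable)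
  show ?thesis
    unfolding is_FP_def using 1 2 by blast
qed

lemma is_FP_FPop:
  assumes x: "L2pos x" shows "is_FP x (FPop x)"
proof -
  have "\<exists>y. y \<in> borel_measurable half_line \<and> sq_norm half_line y < \<infinity> \<and>
     (\<forall>xs. (\<forall>n. FP_dom (xs n)) \<longrightarrow> sq_conv half_line xs x \<longrightarrow> sq_conv half_line (\<lambda>n. FPint (xs n)) y)"
  proof (rule bounded_extension)
    show "FP_dom (trunc x n)" for n by (rule FP_dom_trunc[OF x])
    show "sq_conv half_line (trunc x) x" by (rule sq_conv_trunc[OF x])
  qed (use x in \<open>auto simp: L2pos_iff FPint_finite FPint_bound intro: FP_domD measurable_half_lineI FPint_measurable\<close>)
  then have "\<exists>y. is_FP x y"
    using is_FP_iff[OF x] by (simp add: L2pos_iff)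
  then show ?thesis
    unfolding FPop_def by (rule someI_ex)
qed

section \<open>The operator U\<close>

text \<open>The measure \<open>d\<xi> / \<xi>\<close> on the half-line, which \<open>ln\<close> transports to Lebesgue measure.\<close>

definition log_measure :: "real measure" where
  "log_measure = density lborel (\<lambda>\<xi>. ennreal (indicator {0<..} \<xi> / \<xi>))"

text \<open>Lebesgue measure is determined by its values on intervals, and the integral of 1/\<xi>
  from \<open>exp l\<close> to \<open>exp u\<close> is \<open>u - l\<close>.\<close>

lemma distr_log_measure: "distr log_measure borel ln = lborel"
proof (rule lborel_eqI[symmetric])
  fix l u :: real
  assume *: "\<And>b. b \<in> Basis \<Longrightarrow> l \<bullet> b \<le> u \<bullet> b"
  then have lu: "l \<le> u" by simp
  have "emeasure (distr log_measure borel ln) (box l u) = emeasure log_measure (ln -` {l<..<u})"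
    by (subst emeasure_distr) (auto simp: log_measure_def box_real)
  also have "\<dots> = (\<integral>\<^sup>+\<xi>. ennreal (indicator {0<..} \<xi> / \<xi>) * indicator (ln -` {l<..<u}) \<xi> \<partial>lborel)"
    unfolding log_measure_def by (subst emeasure_density) (auto intro!: measurable_sets_borel[OF borel_measurable_ln])
  also have "\<dots> = (\<integral>\<^sup>+\<xi>. ennreal (1 / \<xi>) * indicator {exp l..exp u} \<xi> \<partial>lborel)"
  proof (rule nn_integral_cong_AE)
    \<comment> \<open>The fundamental theorem is applied on a closed interval, so the two endpoints
      are discarded as null sets. Where \<xi> is not positive the density is 0, whatever value
      \<open>ln\<close> takes.\<close>
    have "AE \<xi> in lborel. \<xi> \<noteq> exp l" "AE \<xi> in lborel. \<xi> \<noteq> exp u"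
      by (rule AE_lborel_singleton)+
    then show "AE \<xi> in lborel. ennreal (indicator {0<..} \<xi> / \<xi>) * indicator (ln -` {l<..<u}) \<xi> = ennreal (1 / \<xi>) * indicator {exp l..exp u} \<xi>"
    proof eventually_elim
      case (elim \<xi>)
      show ?case
      proof (cases "\<xi> > 0")
        case True
        then obtain \<eta> where "\<xi> = exp \<eta>" by (metis exp_ln)
        then have "\<xi> \<in> ln -` {l<..<u} \<longleftrightarrow> \<xi> \<in> {exp l..exp u}"
          using elim by auto
        then show ?thesis using True by (simp add: indicator_def)
      next
        case False
        then have "\<not> exp l \<le> \<xi>" using exp_gt_zero[of l] by linarith
        then show ?thesis using False by simp
      qed
    qed
  qed
  also have "\<dots> = ennreal (ln (exp u) - ln (exp l))"
  proof (rule nn_integral_FTC_Icc[where F=ln and f="\<lambda>\<xi>. 1 / \<xi>"])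
    fix \<xi> assume "\<xi> \<in> {exp l..exp u}"
    then have "\<xi> > 0" using exp_gt_zero[of l] by (simp, linarith)
    then show "(ln has_real_derivative 1 / \<xi>) (at \<xi>)" "0 \<le> 1 / \<xi>"
      by (auto intro!: derivative_eq_intros)
  qed (use lu in auto)
  finally show "emeasure (distr log_measure borel ln) (box l u) = (\<Prod>b\<in>Basis. (u - l) \<bullet> b)"
    by simp
qed simp

text \<open>The substitution \<xi> = exp s, weighted by the square root of its Jacobian so that
  square norms are preserved. For first powers the same weight leaves \<xi> to the power -1/2, the
  weight in \<open>U_dom\<close>.\<close>

definition mellin_pullback :: "(real \<Rightarrow> complex) \<Rightarrow> real \<Rightarrow> complex" where
  "mellin_pullback x s = zext x (exp s) * complex_of_real (exp (s / 2))"

lemma measurable_log_measure: "measurable log_measure N = measurable borel N"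
  by (simp add: log_measure_def measurable_def)

lemma nn_integral_log:
  assumes [measurable]: "F \<in> borel_measurable borel"
  shows "(\<integral>\<^sup>+s. F s \<partial>lborel) = (\<integral>\<^sup>+\<xi>. ennreal (indicator {0<..} \<xi> / \<xi>) * F (ln \<xi>) \<partial>lborel)"
  by (subst distr_log_measure[symmetric], subst nn_integral_distr)
     (auto simp: measurable_log_measure, simp add: log_measure_def nn_integral_density)

lemma integral_log:
  fixes F :: "real \<Rightarrow> complex"
  assumes [measurable]: "F \<in> borel_measurable borel"
  shows "(LINT s|lborel. F s) = (LINT \<xi>|lborel. (indicator {0<..} \<xi> / \<xi>) *\<^sub>R F (ln \<xi>))"
  by (subst distr_log_measure[symmetric], subst integral_distr)
     (auto simp: measurable_log_measure, subst log_measure_def, subst integral_density, auto simp: indicator_def)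

lemma U_domD:
  assumes "U_dom x"
  shows "x \<in> borel_measurable half_line" "sq_norm half_line x < \<infinity>" "zext x \<in> borel_measurable borel"
    "integrable lborel (\<lambda>t. cmod (zext x t) * t powr (-1/2))"
proof -
  show "x \<in> borel_measurable half_line" "sq_norm half_line x < \<infinity>" "zext x \<in> borel_measurable borel"
    using assms by (auto simp: U_dom_def L2pos_iff measurable_half_line_iff)
  have "integrable lborel (\<lambda>t. indicator {0<..} t *\<^sub>R (cmod (x t) * t powr (-1/2)))"
    using assms by (simp add: U_dom_def set_integrable_def)
  also have "(\<lambda>t. indicator {0<..} t *\<^sub>R (cmod (x t) * t powr (-1/2))) = (\<lambda>t. cmod (zext x t) * t powr (-1/2))"
    by (auto simp: zext_def)
  finally show "integrable lborel (\<lambda>t. cmod (zext x t) * t powr (-1/2))" .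
qed

lemma mellin_pullback_measurable [measurable]:
  assumes [measurable]: "zext x \<in> borel_measurable borel"
  shows "mellin_pullback x \<in> borel_measurable borel"
proof -
  have "(\<lambda>s. zext x (exp s) * complex_of_real (exp (s / 2))) \<in> borel_measurable borel"
    by measurable
  then show ?thesis by (simp add: mellin_pullback_def[abs_def])
qed

lemma mellin_pullback_ln: "\<xi> > 0 \<Longrightarrow> mellin_pullback x (ln \<xi>) = zext x \<xi> * complex_of_real (\<xi> powr (1/2))"
  by (simp add: mellin_pullback_def powr_def mult.commute)

lemma powr_half_div: "\<xi> > 0 \<Longrightarrow> \<xi> powr (1/2) / \<xi> = \<xi> powr (-1/2 :: real)"
  using powr_diff[of \<xi> "1/2" 1] by simp

lemma mellin_pullback_integrable:
  assumes "U_dom x" shows "integrable lborel (mellin_pullback x)"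
proof (rule integrableI_bounded)
  note [measurable] = U_domD(3)[OF assms]
  show "mellin_pullback x \<in> borel_measurable lborel" by simp
  have "(\<integral>\<^sup>+s. ennreal (cmod (mellin_pullback x s)) \<partial>lborel) = (\<integral>\<^sup>+\<xi>. ennreal (indicator {0<..} \<xi> / \<xi>) * ennreal (cmod (mellin_pullback x (ln \<xi>))) \<partial>lborel)"
    by (rule nn_integral_log) simp
  also have "\<dots> = (\<integral>\<^sup>+\<xi>. ennreal (cmod (zext x \<xi>) * \<xi> powr (-1/2)) \<partial>lborel)"
  proof (rule nn_integral_cong)
    fix \<xi> :: real
    show "ennreal (indicator {0<..} \<xi> / \<xi>) * ennreal (cmod (mellin_pullback x (ln \<xi>))) = ennreal (cmod (zext x \<xi>) * \<xi> powr (-1/2))"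
    proof (cases "\<xi> > 0")
      case True
      then have "ennreal (indicator {0<..} \<xi> / \<xi>) * ennreal (cmod (mellin_pullback x (ln \<xi>))) = ennreal (cmod (zext x \<xi>) * (\<xi> powr (1/2) / \<xi>))"
        by (simp add: mellin_pullback_ln norm_mult ennreal_mult[symmetric] del: powr_half_sqrt)
      then show ?thesis using powr_half_div[OF True] by simp
    qed (simp add: zext_def)
  qed
  also have "\<dots> < \<infinity>"
    using U_domD(4)[OF assms] by (simp add: integrable_iff_bounded)
  finally show "(\<integral>\<^sup>+s. ennreal (norm (mellin_pullback x s)) \<partial>lborel) < \<infinity>" .
qed

lemma sq_norm_mellin_pullback_diff:
  assumes "U_dom f" "U_dom g"
  shows "(\<integral>\<^sup>+s. ennreal ((cmod (mellin_pullback f s - mellin_pullback g s))\<^sup>2) \<partial>lborel) = sq_norm half_line (\<lambda>t. f t - g t)"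
proof -
  note [measurable] = U_domD(3)[OF assms(1)] U_domD(3)[OF assms(2)]
  have "(\<integral>\<^sup>+s. ennreal ((cmod (mellin_pullback f s - mellin_pullback g s))\<^sup>2) \<partial>lborel)
     = (\<integral>\<^sup>+\<xi>. ennreal (indicator {0<..} \<xi> / \<xi>) * ennreal ((cmod (mellin_pullback f (ln \<xi>) - mellin_pullback g (ln \<xi>)))\<^sup>2) \<partial>lborel)"
    by (rule nn_integral_log) simp
  also have "\<dots> = (\<integral>\<^sup>+\<xi>. ennreal ((cmod (zext (\<lambda>t. f t - g t) \<xi>))\<^sup>2) \<partial>lborel)"
  proof (rule nn_integral_cong)
    fix \<xi> :: real
    show "ennreal (indicator {0<..} \<xi> / \<xi>) * ennreal ((cmod (mellin_pullback f (ln \<xi>) - mellin_pullback g (ln \<xi>)))\<^sup>2) = ennreal ((cmod (zext (\<lambda>t. f t - g t) \<xi>))\<^sup>2)"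
    proof (cases "\<xi> > 0")
      case True
      have "mellin_pullback f (ln \<xi>) - mellin_pullback g (ln \<xi>) = (f \<xi> - g \<xi>) * complex_of_real (\<xi> powr (1/2))"
        using True by (simp only: mellin_pullback_ln) (simp add: zext_def left_diff_distrib)
      moreover have "(\<xi> powr (1/2))\<^sup>2 = \<xi>"
        using True by (simp add: powr_half_sqrt)
      ultimately have "(cmod (mellin_pullback f (ln \<xi>) - mellin_pullback g (ln \<xi>)))\<^sup>2 = (cmod (f \<xi> - g \<xi>))\<^sup>2 * \<xi>"
        by (simp add: norm_mult power_mult_distrib del: powr_half_sqrt)
      then show ?thesis
        using True by (simp add: zext_def ennreal_mult[symmetric])
    qed (simp add: zext_def)
  qed
  finally show ?thesis by (simp add: sq_norm_half_line)
qed

text \<open>This form serves the explicit computation with the Gamma integral;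
  \<open>Uint_eq_fourier\<close> serves the norm estimate.\<close>

lemma Uint_eq_kernel:
  "Uint s x \<mu> = complex_of_real (1 / sqrt (2*pi)) * (LINT \<xi>|lborel. zext x \<xi> * mellin_kernel (s * \<mu>) \<xi>)"
  unfolding Uint_def set_lebesgue_integral_def
  by (intro arg_cong2[where f="(*)"] refl Bochner_Integration.integral_cong)
     (auto simp: zext_def mellin_kernel_def indicator_def)

lemma Uint_eq_fourier:
  assumes "U_dom x"
  shows "Uint s x \<mu> = complex_of_real (1 / sqrt (2*pi)) * fourier (mellin_pullback x) (s * \<mu>)"
proof -
  note [measurable] = U_domD(3)[OF assms]
  have "fourier (mellin_pullback x) (s * \<mu>) = (LINT \<xi>|lborel. (indicator {0<..} \<xi> / \<xi>) *\<^sub>R (mellin_pullback x (ln \<xi>) * exp (\<i> * complex_of_real (s * \<mu> * ln \<xi>))))"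
    unfolding fourier_def by (rule integral_log) simp
  also have "\<dots> = (LINT \<xi>|lborel. zext x \<xi> * mellin_kernel (s * \<mu>) \<xi>)"
  proof (rule Bochner_Integration.integral_cong[OF refl])
    fix \<xi> :: real
    show "(indicator {0<..} \<xi> / \<xi>) *\<^sub>R (mellin_pullback x (ln \<xi>) * exp (\<i> * complex_of_real (s * \<mu> * ln \<xi>))) = zext x \<xi> * mellin_kernel (s * \<mu>) \<xi>"
    proof (cases "\<xi> > 0")
      case True
      have "(indicator {0<..} \<xi> / \<xi>) *\<^sub>R (mellin_pullback x (ln \<xi>) * exp (\<i> * complex_of_real (s * \<mu> * ln \<xi>)))
         = zext x \<xi> * (complex_of_real (\<xi> powr (1/2) / \<xi>) * exp (\<i> * complex_of_real (s * \<mu> * ln \<xi>)))"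
        using True by (simp add: mellin_pullback_ln scaleR_conv_of_real del: powr_half_sqrt)
      then show ?thesis
        using True by (simp only: powr_half_div[OF True]) (simp add: mellin_kernel_def)
    qed (simp add: zext_def)
  qed
  finally show ?thesis by (simp add: Uint_eq_kernel)
qed

lemma Uint_measurable: "U_dom x \<Longrightarrow> Uint s x \<in> borel_measurable borel"
proof -
  assume x: "U_dom x"
  note [measurable] = U_domD(3)[OF x]
  show ?thesis unfolding Uint_eq_fourier[OF x, abs_def] by measurable
qed

text \<open>Plancherel for the pullback, restricted to half of the line. For \<open>s = -1\<close>
  the half is the negative one, and reflection preserves Lebesgue measure.\<close>

lemma Uint_bound:
  assumes f: "U_dom f" and g: "U_dom g" and s: "\<bar>s\<bar> = 1"
  shows "sq_norm half_line (\<lambda>t. Uint s f t - Uint s g t) \<le> sq_norm half_line (\<lambda>t. f t - g t)"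
proof -
  note [measurable] = U_domD(3)[OF f] U_domD(3)[OF g]
  define h where "h = (\<lambda>t. mellin_pullback f t - mellin_pullback g t)"
  have h: "integrable lborel h"
    unfolding h_def using f g by (intro Bochner_Integration.integrable_diff mellin_pullback_integrable)
  then have [measurable]: "h \<in> borel_measurable borel" by auto
  define G where "G = (\<lambda>t. complex_of_real (1 / sqrt (2*pi)) * fourier h t)"
  have [measurable]: "G \<in> borel_measurable borel" unfolding G_def by measurable
  \<comment> \<open>The shape \<open>0 + s * t\<close> is that of the affine substitution rule,
    whose factor \<open>\<bar>s\<bar>\<close> is 1.\<close>
  have eq: "(\<lambda>t. Uint s f t - Uint s g t) = (\<lambda>t. G (0 + s * t))"
    using f g by (simp add: Uint_eq_fourier G_def h_def fourier_diff mellin_pullback_integrable right_diff_distrib)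
  have "sq_norm half_line (\<lambda>t. Uint s f t - Uint s g t) \<le> (\<integral>\<^sup>+t. ennreal ((cmod (G (0 + s * t)))\<^sup>2) \<partial>lborel)"
    unfolding eq by (rule sq_norm_half_line_le)
  also have "\<dots> = ennreal \<bar>s\<bar> * (\<integral>\<^sup>+t. ennreal ((cmod (G (0 + s * t)))\<^sup>2) \<partial>lborel)"
    by (simp add: s)
  also have "\<dots> = (\<integral>\<^sup>+t. ennreal ((cmod (G t))\<^sup>2) \<partial>lborel)"
    using s by (intro nn_integral_real_affine[symmetric]) auto
  also have "\<dots> \<le> (\<integral>\<^sup>+x. ennreal ((cmod (h x))\<^sup>2) \<partial>lborel)"
    unfolding G_def by (rule plancherel_normalized[OF h])
  also have "\<dots> = sq_norm half_line (\<lambda>t. f t - g t)"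
    unfolding h_def by (rule sq_norm_mellin_pullback_diff[OF f g])
  finally show ?thesis .
qed

section \<open>Extension of the two components of U\<close>

lemma Uint_zero: "Uint s (\<lambda>_. 0) = (\<lambda>_. 0)"
  by (simp add: Uint_def set_lebesgue_integral_def fun_eq_iff)

lemma Uint_finite:
  assumes f: "U_dom f" and s: "\<bar>s\<bar> = 1"
  shows "sq_norm half_line (Uint s f) < top"
proof -
  have "U_dom (\<lambda>_. 0)"
    by (simp add: U_dom_def L2pos_def set_borel_measurable_def set_integrable_def)
  from Uint_bound[OF f this s] U_domD(2)[OF f] show ?thesis
    by (simp add: Uint_zero)
qed

text \<open>One component of \<^const>\<open>is_U\<close>: \<open>s = 1\<close> for \<open>(Ux)\<^sub>+\<close>, and \<open>s = -1\<close> for \<open>(Ux)\<^sub>-\<close>.\<close>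

definition U_ext :: "real \<Rightarrow> (real \<Rightarrow> complex) \<Rightarrow> (real \<Rightarrow> complex) \<Rightarrow> bool" where
  "U_ext s x p \<longleftrightarrow> L2pos p \<and>
     (\<forall>xs. (\<forall>n. U_dom (xs n)) \<longrightarrow> sq_conv half_line xs x \<longrightarrow> sq_conv half_line (\<lambda>n. Uint s (xs n)) p)"

lemma L2pos_Uint: "U_dom f \<Longrightarrow> \<bar>s\<bar> = 1 \<Longrightarrow> L2pos (Uint s f)"
  by (simp add: L2pos_iff Uint_finite measurable_half_lineI Uint_measurable)

lemma is_U_iff:
  assumes x: "L2pos x"
  shows "is_U x pm \<longleftrightarrow> U_ext 1 x (fst pm) \<and> U_ext (-1) x (snd pm)"
proof -
  have 1: "L2conv xs x = sq_conv half_line xs x" if "\<forall>n. U_dom (xs n)" for xs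
    using that x by (intro L2conv_iff) (auto simp: U_dom_def)
  have 2: "L2conv (\<lambda>n. Uint s (xs n)) p = sq_conv half_line (\<lambda>n. Uint s (xs n)) p"
    if "\<forall>n. U_dom (xs n)" "L2pos p" "\<bar>s\<bar> = 1" for xs p s
    using that by (intro L2conv_iff L2pos_Uint) auto
  show ?thesis
    unfolding is_U_def U_ext_def using 1 2[of _ "fst pm" 1] 2[of _ "snd pm" "-1"] by auto
qed

lemma U_ext_exists:
  assumes x: "L2pos x" and s: "\<bar>s\<bar> = 1"
  shows "\<exists>p. U_ext s x p"
proof -
  have "\<exists>y. y \<in> borel_measurable half_line \<and> sq_norm half_line y < \<infinity> \<and>
     (\<forall>xs. (\<forall>n. U_dom (xs n)) \<longrightarrow> sq_conv half_line xs x \<longrightarrow> sq_conv half_line (\<lambda>n. Uint s (xs n)) y)"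
  proof (rule bounded_extension)
    show "U_dom (trunc x n)" for n by (rule U_dom_trunc[OF x])
    show "sq_conv half_line (trunc x) x" by (rule sq_conv_trunc[OF x])
  qed (use x s in \<open>auto simp: L2pos_iff Uint_finite Uint_bound intro: U_domD measurable_half_lineI Uint_measurable\<close>)
  then show ?thesis by (simp add: U_ext_def L2pos_iff)
qed

lemma U_ext_Uop:
  assumes x: "L2pos x"
  shows "U_ext 1 x (fst (Uop x))" "U_ext (-1) x (snd (Uop x))"
proof -
  obtain p m where "U_ext 1 x p" "U_ext (-1) x m"
    using U_ext_exists[OF x, of 1] U_ext_exists[OF x, of "-1"] by auto
  then have "is_U x (p, m)" by (simp add: is_U_iff[OF x])
  then have "is_U x (Uop x)" unfolding Uop_def by (rule someI)
  then show "U_ext 1 x (fst (Uop x))" "U_ext (-1) x (snd (Uop x))"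
    by (simp_all add: is_U_iff[OF x])
qed

text \<open>Continuity of the extension, obtained from the contraction on truncations. The 4 is two
  applications of \<open>sq_norm_triangle\<close> with a factor 2 each.\<close>

lemma U_ext_bound:
  assumes x: "L2pos x" "L2pos x'" and p: "U_ext s x p" "U_ext s x' p'" and s: "\<bar>s\<bar> = 1"
  shows "sq_norm half_line (\<lambda>t. p t - p' t) \<le> 4 * sq_norm half_line (\<lambda>t. x t - x' t)"
proof -
  let ?U = "\<lambda>n. Uint s (trunc x n)" and ?U' = "\<lambda>n. Uint s (trunc x' n)"
  have [measurable]: "p \<in> borel_measurable half_line" "p' \<in> borel_measurable half_line"
    using p by (auto simp: U_ext_def L2pos_iff)
  have [measurable]: "?U n \<in> borel_measurable half_line" "?U' n \<in> borel_measurable half_line" for n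
    using x by (auto intro!: measurable_half_lineI Uint_measurable U_dom_trunc)
  have c: "sq_conv half_line ?U p" "sq_conv half_line ?U' p'"
    using p x by (auto simp: U_ext_def U_dom_trunc sq_conv_trunc)
  \<comment> \<open>\<open>b\<close> collects the two approximation errors; they vanish in the limit
    and only the distance between \<open>x\<close> and \<open>x'\<close> remains.\<close>
  define b where "b = (\<lambda>n. 2 * sq_norm half_line (\<lambda>t. ?U n t - p t) + 4 * sq_norm half_line (\<lambda>t. ?U' n t - p' t))"
  have b: "b \<longlonglongrightarrow> 0"
    using c unfolding sq_conv_def
    by (rule ennreal_tendsto_0_add[where A=2 and B=4]) (simp add: b_def)
  have "sq_norm half_line (\<lambda>t. p t - p' t) \<le> b n + 4 * sq_norm half_line (\<lambda>t. x t - x' t)" for n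
  proof -
    have "sq_norm half_line (\<lambda>t. p t - p' t) \<le> 2 * sq_norm half_line (\<lambda>t. p t - ?U n t) + 2 * sq_norm half_line (\<lambda>t. ?U n t - p' t)"
      by (rule sq_norm_triangle) auto
    also have "sq_norm half_line (\<lambda>t. ?U n t - p' t) \<le> 2 * sq_norm half_line (\<lambda>t. ?U n t - ?U' n t) + 2 * sq_norm half_line (\<lambda>t. ?U' n t - p' t)"
      by (rule sq_norm_triangle) auto
    also have "sq_norm half_line (\<lambda>t. ?U n t - ?U' n t) \<le> sq_norm half_line (\<lambda>t. trunc x n t - trunc x' n t)"
      by (intro Uint_bound U_dom_trunc x s)
    also have "\<dots> \<le> sq_norm half_line (\<lambda>t. x t - x' t)"
      unfolding sq_norm_def by (intro nn_integral_mono) (simp add: trunc_def indicator_def)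
    finally show ?thesis
      by (simp add: b_def sq_norm_commute[of _ p] distrib_left mult.assoc[symmetric] add_ac add_left_mono mult_left_mono)
  qed
  moreover have "(\<lambda>n. b n + 4 * sq_norm half_line (\<lambda>t. x t - x' t)) \<longlonglongrightarrow> 0 + 4 * sq_norm half_line (\<lambda>t. x t - x' t)"
    by (intro tendsto_add b tendsto_const)
  ultimately show ?thesis
    by (intro LIMSEQ_le_const[where X="\<lambda>n. b n + 4 * sq_norm half_line (\<lambda>t. x t - x' t)"]) auto
qed

section \<open>The intertwining identity\<close>

text \<open>A majorant free of \<epsilon>: the modulus of the base is at least \<xi>, and the
  argument contributes at most exp (\<bar>\<nu>\<bar> pi). The remaining \<xi> to the power -1/2 is
  the weight for which \<open>U_dom\<close> guarantees integrability.\<close>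

lemma powr_kernel_bound:
  assumes \<xi>: "\<xi> > 0" and e: "\<epsilon> > 0"
  shows "cmod (Complex \<epsilon> (- \<xi>) powr (- (1/2 + \<i> * complex_of_real \<nu>))) \<le> \<xi> powr (-1/2) * exp (\<bar>\<nu>\<bar> * pi)"
proof -
  define z where "z = Complex \<epsilon> (- \<xi>)"
  have z: "z \<noteq> 0" "cmod z \<ge> \<xi>"
    using \<xi> abs_Im_le_cmod[of z] by (auto simp: z_def complex_eq_iff)
  have "cmod (z powr (- (1/2 + \<i> * complex_of_real \<nu>))) = exp (- (1/2) * ln (cmod z) + \<nu> * Im (Ln z))"
    using z by (simp add: powr_def)
  also have "\<dots> = cmod z powr (-1/2) * exp (\<nu> * Im (Ln z))"
    using z by (simp add: powr_def flip: exp_add)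
  also have "\<dots> \<le> \<xi> powr (-1/2) * exp (\<bar>\<nu>\<bar> * pi)"
  proof (intro mult_mono)
    show "cmod z powr (-1/2) \<le> \<xi> powr (-1/2)"
      using \<xi> z by (intro powr_mono2') auto
    have "\<nu> * Im (Ln z) \<le> \<bar>\<nu>\<bar> * \<bar>Im (Ln z)\<bar>"
      by (simp flip: abs_mult)
    also have "\<dots> \<le> \<bar>\<nu>\<bar> * pi"
      using z mpi_less_Im_Ln[of z] Im_Ln_le_pi[of z] by (intro mult_left_mono) auto
    finally show "exp (\<nu> * Im (Ln z)) \<le> exp (\<bar>\<nu>\<bar> * pi)" by simp
  qed auto
  finally show ?thesis by (simp add: z_def)
qed

text \<open>The logarithm of the base is ln \<xi> - i pi/2. In its product with -(1/2 + i \<nu>),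
  the term - i pi/2 gives the phase i pi/4 and the exponent - pi \<nu> / 2, while ln \<xi> gives the
  kernel at - \<nu>.\<close>

lemma powr_kernel_limit:
  assumes \<xi>: "\<xi> > 0"
  shows "(- \<i> * complex_of_real \<xi>) powr (- (1/2 + \<i> * complex_of_real \<nu>))
    = exp (\<i> * complex_of_real (pi/4)) * complex_of_real (exp (- (pi/2) * \<nu>)) * mellin_kernel (- \<nu>) \<xi>"
proof -
  have Ln: "Ln (- \<i> * complex_of_real \<xi>) = complex_of_real (ln \<xi>) - \<i> * complex_of_real (pi / 2)"
  proof -
    have "Ln (- \<i> * complex_of_real \<xi>) = Ln (complex_of_real \<xi> * (- \<i>))"
      by (simp add: mult.commute)
    also have "\<dots> = complex_of_real (ln \<xi>) + Ln (- \<i>)"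
      using \<xi> Ln_times_of_real[of \<xi> "- \<i>"] by (simp add: Ln_of_real)
    finally show ?thesis by simp
  qed
  have ii: "\<i> * (\<i> * x) = - x" for x
    by (simp add: mult.assoc[symmetric])
  have "(- \<i> * complex_of_real \<xi>) powr (- (1/2 + \<i> * complex_of_real \<nu>))
    = exp (- (1/2 + \<i> * complex_of_real \<nu>) * (complex_of_real (ln \<xi>) - \<i> * complex_of_real (pi / 2)))"
    using \<xi> unfolding powr_def Ln by auto
  also have "- (1/2 + \<i> * complex_of_real \<nu>) * (complex_of_real (ln \<xi>) - \<i> * complex_of_real (pi / 2))
    = \<i> * complex_of_real (pi/4) + complex_of_real (- (pi/2) * \<nu>) + (complex_of_real (-1/2 * ln \<xi>) + \<i> * complex_of_real (- \<nu> * ln \<xi>))"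
    by (simp add: algebra_simps ii)
  also have "exp \<dots> = exp (\<i> * complex_of_real (pi/4)) * exp (complex_of_real (- (pi/2) * \<nu>)) *
      (exp (complex_of_real (-1/2 * ln \<xi>)) * exp (\<i> * complex_of_real (- \<nu> * ln \<xi>)))"
    by (simp only: exp_add)
  also have "exp (complex_of_real (-1/2 * ln \<xi>)) * exp (\<i> * complex_of_real (- \<nu> * ln \<xi>)) = mellin_kernel (- \<nu>) \<xi>"
    using \<xi> by (simp only: exp_of_real) (simp add: mellin_kernel_def powr_def)
  finally show ?thesis
    by (simp only: exp_of_real)
qed

section \<open>Damped transforms and their limit\<close>

definition damped :: "(real \<Rightarrow> complex) \<Rightarrow> nat \<Rightarrow> real \<Rightarrow> complex" where
  "damped x n t = complex_of_real (exp (- (1 / real (Suc n)) * t)) * FPint x t"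

lemma damped_measurable: "FP_dom x \<Longrightarrow> damped x n \<in> borel_measurable borel"
proof -
  assume "FP_dom x"
  then have [measurable]: "FPint x \<in> borel_measurable borel" by (rule FPint_measurable)
  have "(\<lambda>t. complex_of_real (exp (- (1 / real (Suc n)) * t)) * FPint x t) \<in> borel_measurable borel"
    by measurable
  then show ?thesis by (simp add: damped_def[abs_def])
qed

lemma norm_damped_le: "t > 0 \<Longrightarrow> cmod (damped x n t) \<le> cmod (FPint x t)"
  by (simp add: damped_def norm_mult mult_left_le_one_le)

lemma FPint_bounded: "cmod (FPint x t) \<le> (1 / sqrt (2*pi)) * (LINT \<xi>|lborel. cmod (zext x \<xi>))"
  unfolding FPint_eq_fourier norm_mult
  by (intro mult_mono norm_fourier_le) (auto simp: norm_divide)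

lemma L2pos_FPint: "FP_dom x \<Longrightarrow> L2pos (FPint x)"
  by (simp add: L2pos_iff FPint_finite measurable_half_lineI FPint_measurable)

lemma L2pos_damped: "FP_dom x \<Longrightarrow> L2pos (damped x n)"
proof -
  assume x: "FP_dom x"
  have "sq_norm half_line (damped x n) \<le> sq_norm half_line (FPint x)"
    unfolding sq_norm_def by (intro nn_integral_mono ennreal_leI power_mono norm_damped_le) auto
  then show ?thesis
    using L2pos_FPint[OF x] by (auto simp: L2pos_iff intro: measurable_half_lineI damped_measurable[OF x])
qed

text \<open>\<open>FPint x\<close> is bounded, but \<open>t powr (-1/2)\<close> is not integrable at
  infinity; the exponential factor repairs this, and the majorant is the Gamma integrand at \<nu> =
  0.\<close>

lemma U_dom_damped:
  assumes x: "FP_dom x"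
  shows "U_dom (damped x n)"
proof -
  define a where "a = 1 / real (Suc n)"
  have a: "a > 0" by (simp add: a_def)
  define C where "C = (1 / sqrt (2*pi)) * (LINT \<xi>|lborel. cmod (zext x \<xi>))"
  have [measurable]: "damped x n \<in> borel_measurable borel" by (rule damped_measurable[OF x])
  have "integrable lborel (\<lambda>t. indicator {0<..} t *\<^sub>R (cmod (damped x n t) * t powr (-1/2)))"
  proof (rule Bochner_Integration.integrable_bound)
    show "integrable lborel (\<lambda>t. C * (cmod (mellin_kernel 0 t) * exp (- a * t)))"
      by (intro integrable_mult_right mellin_kernel_integrable a)
    show "AE t in lborel. norm (indicator {0<..} t *\<^sub>R (cmod (damped x n t) * t powr (-1/2))) \<le> norm (C * (cmod (mellin_kernel 0 t) * exp (- a * t)))"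
    proof (rule AE_I2)
      fix t
      show "norm (indicator {0<..} t *\<^sub>R (cmod (damped x n t) * t powr (-1/2))) \<le> norm (C * (cmod (mellin_kernel 0 t) * exp (- a * t)))"
      proof (cases "t > 0")
        case True
        have "cmod (damped x n t) * t powr (-1/2) = cmod (FPint x t) * (t powr (-1/2) * exp (- a * t))"
          by (simp add: damped_def a_def norm_mult)
        also have "\<dots> \<le> C * (t powr (-1/2) * exp (- a * t))"
          unfolding C_def by (intro mult_right_mono FPint_bounded) auto
        also have "\<dots> \<le> \<bar>C * (t powr (-1/2) * exp (- a * t))\<bar>"
          by (rule abs_ge_self)
        finally have "cmod (damped x n t) * t powr (-1/2) \<le> \<bar>C * (t powr (-1/2) * exp (- a * t))\<bar>" .
        then show ?thesis
          using True by (simp only: norm_mellin_kernel) (simp add: abs_mult)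
      qed simp
    qed
  qed measurable
  then show ?thesis
    using L2pos_damped[OF x] by (simp add: U_dom_def set_integrable_def)
qed

lemma sq_conv_damped:
  assumes x: "FP_dom x"
  shows "sq_conv half_line (damped x) (FPint x)"
proof -
  have [measurable]: "FPint x \<in> borel_measurable half_line" "\<And>n. damped x n \<in> borel_measurable half_line"
    using x by (auto intro: measurable_half_lineI damped_measurable FPint_measurable)
  have eq: "cmod (damped x n t - FPint x t) = (1 - exp (- (1 / real (Suc n)) * t)) * cmod (FPint x t)" if "t > 0" for n t
  proof -
    have "damped x n t - FPint x t = - (complex_of_real (1 - exp (- (1 / real (Suc n)) * t)) * FPint x t)"
      by (simp add: damped_def algebra_simps)
    moreover have "exp (- (1 / real (Suc n)) * t) \<le> 1"
      using that by simp
    ultimately show ?thesis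
      by (simp only: norm_minus_cancel norm_mult norm_of_real abs_of_nonneg diff_ge_0_iff_ge)
  qed
  have "(\<lambda>n. \<integral>\<^sup>+t. ennreal ((cmod (damped x n t - FPint x t))\<^sup>2) \<partial>half_line) \<longlonglongrightarrow> (\<integral>\<^sup>+t. 0 \<partial>half_line)"
  proof (rule nn_integral_dominated_convergence[where w="\<lambda>t. ennreal ((cmod (FPint x t))\<^sup>2)"])
    show "(\<integral>\<^sup>+t. ennreal ((cmod (FPint x t))\<^sup>2) \<partial>half_line) < \<infinity>"
      using FPint_finite[OF x] by (simp add: sq_norm_def)
    show "AE t in half_line. ennreal ((cmod (damped x n t - FPint x t))\<^sup>2) \<le> ennreal ((cmod (FPint x t))\<^sup>2)" for n
      by (rule AE_I2, intro ennreal_leI power_mono) (auto simp: eq mult_left_le_one_le)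
    show "AE t in half_line. (\<lambda>n. ennreal ((cmod (damped x n t - FPint x t))\<^sup>2)) \<longlonglongrightarrow> 0"
    proof (rule AE_I2)
      fix t assume "t \<in> space half_line"
      then have t: "t > 0" by simp
      have "(\<lambda>n. (1 - exp (- (1 / real (Suc n)) * t)) * cmod (FPint x t)) \<longlonglongrightarrow> (1 - exp (- 0 * t)) * cmod (FPint x t)"
        by (intro tendsto_intros LIMSEQ_Suc[OF lim_1_over_n])
      then have "(\<lambda>n. ennreal ((cmod (damped x n t - FPint x t))\<^sup>2)) \<longlonglongrightarrow> ennreal (((1 - exp (- 0 * t)) * cmod (FPint x t))\<^sup>2)"
        unfolding eq[OF t] by (intro tendsto_ennrealI tendsto_power)
      then show "(\<lambda>n. ennreal ((cmod (damped x n t - FPint x t))\<^sup>2)) \<longlonglongrightarrow> 0" by simp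
    qed
  qed auto
  then show ?thesis by (simp add: sq_conv_def sq_norm_def)
qed

text \<open>With the damping included the outer kernel \<open>K\<close> is integrable, so the
  integrals may be exchanged. Damping and oscillation then merge into exp (- z t) with z = a - i
  \<xi>, to which \<open>mellin_gamma\<close> applies.\<close>

lemma damped_mellin:
  assumes x: "FP_dom x" and a: "a = 1 / real (Suc n)"
  shows "(LINT t|lborel. zext (damped x n) t * mellin_kernel \<nu> t) = complex_of_real (1 / sqrt (2*pi)) *
     (LINT \<xi>|lborel. zext x \<xi> * (Gamma (1/2 + \<i> * complex_of_real \<nu>) * Complex a (- \<xi>) powr (- (1/2 + \<i> * complex_of_real \<nu>))))"
proof -
  have apos: "a > 0" by (simp add: a)
  define K where "K = (\<lambda>t. mellin_kernel \<nu> t * exp (- complex_of_real a * complex_of_real t))"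
  have K: "integrable lborel K"
    unfolding K_def using apos
    by (intro laplace_integrable) (auto simp: mellin_kernel_nonpos intro: mellin_kernel_integrable[simplified])
  have X: "integrable lborel (zext x)" by (rule FP_domD(3)[OF x])
  have "(LINT t|lborel. zext (damped x n) t * mellin_kernel \<nu> t)
     = (LINT t|lborel. complex_of_real (1 / sqrt (2*pi)) * (LINT \<xi>|lborel. K t * zext x \<xi> * exp (\<i> * complex_of_real (t * \<xi>))))"
  proof (rule Bochner_Integration.integral_cong[OF refl])
    fix t
    have "(LINT \<xi>|lborel. K t * zext x \<xi> * exp (\<i> * complex_of_real (t * \<xi>))) = K t * fourier (zext x) t"
      by (simp add: fourier_def mult.assoc)
    moreover have "zext (damped x n) t * mellin_kernel \<nu> t = complex_of_real (1 / sqrt (2*pi)) * (K t * fourier (zext x) t)"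
      by (cases "t > 0")
         (simp_all add: zext_def[of "damped x n"] damped_def FPint_eq_fourier K_def a mellin_kernel_nonpos exp_of_real[symmetric] mult_ac)
    ultimately show "zext (damped x n) t * mellin_kernel \<nu> t = complex_of_real (1 / sqrt (2*pi)) * (LINT \<xi>|lborel. K t * zext x \<xi> * exp (\<i> * complex_of_real (t * \<xi>)))"
      by simp
  qed
  also have "\<dots> = complex_of_real (1 / sqrt (2*pi)) * (LINT t|lborel. (LINT \<xi>|lborel. K t * zext x \<xi> * exp (\<i> * complex_of_real (t * \<xi>))))"
    by (rule integral_mult_right_zero)
  also have "(LINT t|lborel. (LINT \<xi>|lborel. K t * zext x \<xi> * exp (\<i> * complex_of_real (t * \<xi>))))
     = (LINT \<xi>|lborel. (LINT t|lborel. K t * zext x \<xi> * exp (\<i> * complex_of_real (t * \<xi>))))"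
    by (rule Fubini_mult_bounded[OF K X, symmetric]) auto
  also have "\<dots> = (LINT \<xi>|lborel. zext x \<xi> * (Gamma (1/2 + \<i> * complex_of_real \<nu>) * Complex a (- \<xi>) powr (- (1/2 + \<i> * complex_of_real \<nu>))))"
  proof (rule Bochner_Integration.integral_cong[OF refl])
    fix \<xi>
    have "(LINT t|lborel. K t * zext x \<xi> * exp (\<i> * complex_of_real (t * \<xi>)))
       = (LINT t|lborel. zext x \<xi> * (mellin_kernel \<nu> t * exp (- Complex a (- \<xi>) * complex_of_real t)))"
      by (rule Bochner_Integration.integral_cong[OF refl])
         (simp add: K_def Complex_eq mult_ac exp_add[symmetric] algebra_simps)
    also have "\<dots> = zext x \<xi> * (Gamma (1/2 + \<i> * complex_of_real \<nu>) * Complex a (- \<xi>) powr (- (1/2 + \<i> * complex_of_real \<nu>)))"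
      by (subst integral_mult_right_zero, subst mellin_gamma) (use apos in auto)
    finally show "(LINT t|lborel. K t * zext x \<xi> * exp (\<i> * complex_of_real (t * \<xi>)))
       = zext x \<xi> * (Gamma (1/2 + \<i> * complex_of_real \<nu>) * Complex a (- \<xi>) powr (- (1/2 + \<i> * complex_of_real \<nu>)))" .
  qed
  finally show ?thesis .
qed

text \<open>\<open>FP_dom\<close> gives the interchange for each \<open>n\<close>,
  \<open>U_dom\<close> the majorant for the limit. The limit exists at every \<mu>, and the reversed
  sign in the limiting kernel turns component \<open>s\<close> of U into component
  \<open>- s\<close>.\<close>

lemma Uint_damped_tendsto:
  assumes x: "FP_dom x" "U_dom x"
  shows "(\<lambda>n. Uint s (damped x n) \<mu>) \<longlonglongrightarrow> F_pm (s * \<mu>) * Uint (- s) x \<mu>"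
proof -
  define \<nu> where "\<nu> = s * \<mu>"
  define G where "G = Gamma (1/2 + \<i> * complex_of_real \<nu>)"
  define P where "P = (\<lambda>n \<xi>. Complex (1 / real (Suc n)) (- \<xi>) powr (- (1/2 + \<i> * complex_of_real \<nu>)))"
  define E where "E = exp (\<i> * complex_of_real (pi/4)) * complex_of_real (exp (- (pi/2) * \<nu>))"
  define c where "c = complex_of_real (1 / sqrt (2*pi))"
  note [measurable] = U_domD(3)[OF x(2)]
  have [measurable]: "P n \<in> borel_measurable borel" for n
  proof -
    \<comment> \<open>The base has real part \<open>1 / real (Suc n)\<close>, so it is never 0 and
      the exceptional case of \<open>powr\<close> does not arise.\<close>
    have "P n = (\<lambda>\<xi>. exp (- (1/2 + \<i> * complex_of_real \<nu>) * Ln (complex_of_real (1 / real (Suc n)) - \<i> * complex_of_real \<xi>)))"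
      by (auto simp: P_def powr_def Complex_eq complex_eq_iff fun_eq_iff)
    then show ?thesis by simp
  qed
  have lim: "(\<lambda>n. LINT \<xi>|lborel. zext x \<xi> * (G * P n \<xi>)) \<longlonglongrightarrow> (LINT \<xi>|lborel. zext x \<xi> * (G * (E * mellin_kernel (- \<nu>) \<xi>)))"
  proof (rule integral_dominated_convergence)
    show "integrable lborel (\<lambda>\<xi>. (cmod G * exp (\<bar>\<nu>\<bar> * pi)) * (cmod (zext x \<xi>) * \<xi> powr (-1/2)))"
      by (intro integrable_mult_right U_domD x)
    show "AE \<xi> in lborel. (\<lambda>n. zext x \<xi> * (G * P n \<xi>)) \<longlonglongrightarrow> zext x \<xi> * (G * (E * mellin_kernel (- \<nu>) \<xi>))"
    proof (rule AE_I2)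
      fix \<xi>
      show "(\<lambda>n. zext x \<xi> * (G * P n \<xi>)) \<longlonglongrightarrow> zext x \<xi> * (G * (E * mellin_kernel (- \<nu>) \<xi>))"
      proof (cases "\<xi> > 0")
        case True
        have "(\<lambda>n. complex_of_real (1 / real (Suc n)) - \<i> * complex_of_real \<xi>) \<longlonglongrightarrow> complex_of_real 0 - \<i> * complex_of_real \<xi>"
          by (intro tendsto_diff tendsto_of_real tendsto_const LIMSEQ_Suc[OF lim_1_over_n])
        then have "(\<lambda>n. Complex (1 / real (Suc n)) (- \<xi>)) \<longlonglongrightarrow> - \<i> * complex_of_real \<xi>"
          by (simp add: Complex_eq)
        then have "(\<lambda>n. P n \<xi>) \<longlonglongrightarrow> (- \<i> * complex_of_real \<xi>) powr (- (1/2 + \<i> * complex_of_real \<nu>))"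
          unfolding P_def using True
          by (intro tendsto_powr_complex tendsto_const) (auto simp: complex_nonpos_Reals_iff)
        then have "(\<lambda>n. P n \<xi>) \<longlonglongrightarrow> E * mellin_kernel (- \<nu>) \<xi>"
          using powr_kernel_limit[OF True] by (simp add: E_def)
        then show ?thesis by (intro tendsto_mult_left)
      qed (simp add: zext_def)
    qed
    show "AE \<xi> in lborel. cmod (zext x \<xi> * (G * P n \<xi>)) \<le> (cmod G * exp (\<bar>\<nu>\<bar> * pi)) * (cmod (zext x \<xi>) * \<xi> powr (-1/2))" for n
    proof (rule AE_I2)
      fix \<xi>
      show "cmod (zext x \<xi> * (G * P n \<xi>)) \<le> (cmod G * exp (\<bar>\<nu>\<bar> * pi)) * (cmod (zext x \<xi>) * \<xi> powr (-1/2))"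
      proof (cases "\<xi> > 0")
        case True
        have "cmod (P n \<xi>) \<le> \<xi> powr (-1/2) * exp (\<bar>\<nu>\<bar> * pi)"
          unfolding P_def by (rule powr_kernel_bound[OF True]) simp
        then have "(cmod (zext x \<xi>) * cmod G) * cmod (P n \<xi>) \<le> (cmod (zext x \<xi>) * cmod G) * (\<xi> powr (-1/2) * exp (\<bar>\<nu>\<bar> * pi))"
          by (intro mult_left_mono) auto
        then show ?thesis by (simp add: norm_mult mult_ac)
      qed (simp add: zext_def)
    qed
  qed measurable
  \<comment> \<open>One \<open>c\<close> comes from U and one from the Fourier integral; in the
    limit one goes into \<open>F_pm\<close>, the other into \<open>Uint (- s) x\<close>.\<close>
  have "Uint s (damped x n) \<mu> = c * (c * (LINT \<xi>|lborel. zext x \<xi> * (G * P n \<xi>)))" for n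
    unfolding Uint_eq_kernel \<nu>_def[symmetric] damped_mellin[OF x(1) refl] c_def P_def G_def ..
  moreover have "(\<lambda>n. c * (c * (LINT \<xi>|lborel. zext x \<xi> * (G * P n \<xi>)))) \<longlonglongrightarrow> c * (c * (LINT \<xi>|lborel. zext x \<xi> * (G * (E * mellin_kernel (- \<nu>) \<xi>))))"
    by (intro tendsto_mult_left lim)
  moreover have "c * (c * (LINT \<xi>|lborel. zext x \<xi> * (G * (E * mellin_kernel (- \<nu>) \<xi>)))) = F_pm (s * \<mu>) * Uint (- s) x \<mu>"
  proof -
    have "(LINT \<xi>|lborel. zext x \<xi> * (G * (E * mellin_kernel (- \<nu>) \<xi>))) = (LINT \<xi>|lborel. (G * E) * (zext x \<xi> * mellin_kernel (- \<nu>) \<xi>))"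
      by (simp only: mult_ac)
    also have "\<dots> = (G * E) * (LINT \<xi>|lborel. zext x \<xi> * mellin_kernel (- \<nu>) \<xi>)"
      by (rule integral_mult_right_zero)
    finally show ?thesis
      unfolding Uint_eq_kernel F_pm_def \<nu>_def[symmetric] minus_mult_left[symmetric] c_def[symmetric] G_def[symmetric] E_def
      by (simp only: mult_ac)
  qed
  ultimately show ?thesis by simp
qed

lemma U_ext_FPint:
  assumes x: "FP_dom x" "U_dom x" and z: "U_ext s (FPint x) z" and s: "\<bar>s\<bar> = 1"
  shows "AE \<mu> in half_line. z \<mu> = F_pm (s * \<mu>) * Uint (- s) x \<mu>"
proof -
  have "sq_conv half_line (\<lambda>n. Uint s (damped x n)) z"
    using z x by (auto simp: U_ext_def U_dom_damped sq_conv_damped)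
  moreover have "Uint s (damped x n) \<in> borel_measurable half_line" for n
    by (intro measurable_half_lineI Uint_measurable U_dom_damped x)
  moreover have "z \<in> borel_measurable half_line"
    using z by (simp add: U_ext_def L2pos_iff)
  ultimately obtain r :: "nat \<Rightarrow> nat" where r: "strict_mono r"
    and ae: "AE \<mu> in half_line. (\<lambda>n. Uint s (damped x (r n)) \<mu>) \<longlonglongrightarrow> z \<mu>"
    using sq_conv_AE_subseq[of "\<lambda>n. Uint s (damped x n)" half_line z] by auto
  from ae show ?thesis
  proof eventually_elim
    case (elim \<mu>)
    have "(\<lambda>n. Uint s (damped x (r n)) \<mu>) \<longlonglongrightarrow> F_pm (s * \<mu>) * Uint (- s) x \<mu>"
      using LIMSEQ_subseq_LIMSEQ[OF Uint_damped_tendsto[OF x, of s \<mu>] r] by (simp add: o_def)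
    with elim show ?case by (rule LIMSEQ_unique)
  qed
qed

text \<open>The identity for truncations is passed to the limit pointwise along a common
  subsequence, so at each \<mu> the factor \<open>F_pm (s * \<mu>)\<close> is just a
  constant.\<close>

lemma U_ext_FPop:
  assumes x: "L2pos x" and z: "U_ext s (FPop x) z" and y: "U_ext (- s) x y" and s: "\<bar>s\<bar> = 1"
  shows "AE \<mu> in half_line. z \<mu> = F_pm (s * \<mu>) * y \<mu>"
proof -
  have FP: "L2pos (FPop x)" and FPc: "sq_conv half_line (\<lambda>n. FPint (trunc x n)) (FPop x)"
    using is_FP_FPop[OF x] is_FP_iff[OF x] FP_dom_trunc[OF x] sq_conv_trunc[OF x] by auto
  have "\<forall>n. \<exists>p. U_ext s (FPint (trunc x n)) p"
    by (intro allI U_ext_exists L2pos_FPint FP_dom_trunc x s)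
  then obtain p where p: "\<And>n. U_ext s (FPint (trunc x n)) (p n)"
    by metis
  have [measurable]: "p n \<in> borel_measurable half_line" "z \<in> borel_measurable half_line" "y \<in> borel_measurable half_line" for n
    using p z y by (auto simp: U_ext_def L2pos_iff)
  have [measurable]: "Uint (- s) (trunc x n) \<in> borel_measurable half_line" for n
    by (intro measurable_half_lineI Uint_measurable U_dom_trunc x)
  have pc: "sq_conv half_line p z"
    unfolding sq_conv_def
  \<comment> \<open>By \<open>U_ext_bound\<close> the errors of \<open>p\<close> are controlled by
    those of the transforms alone; the second summand of the rule is switched off by
    \<open>B=0\<close>.\<close>
  proof (rule ennreal_tendsto_0_add[OF FPc[unfolded sq_conv_def] FPc[unfolded sq_conv_def], where A=4 and B=0])
    fix n
    show "sq_norm half_line (\<lambda>t. p n t - z t) \<le> ennreal 4 * sq_norm half_line (\<lambda>t. FPint (trunc x n) t - FPop x t) + ennreal 0 * sq_norm half_line (\<lambda>t. FPint (trunc x n) t - FPop x t)"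
      using U_ext_bound[OF L2pos_FPint[OF FP_dom_trunc[OF x]] FP p z s] by simp
  qed
  obtain r :: "nat \<Rightarrow> nat" where r: "strict_mono r" and r_ae: "AE \<mu> in half_line. (\<lambda>n. p (r n) \<mu>) \<longlonglongrightarrow> z \<mu>"
    using sq_conv_AE_subseq[OF _ _ pc] by auto
  have "sq_conv half_line (\<lambda>n. Uint (- s) (trunc x n)) y"
    using y x by (auto simp: U_ext_def U_dom_trunc sq_conv_trunc)
  from LIMSEQ_subseq_LIMSEQ[OF this[unfolded sq_conv_def] r]
  have "sq_conv half_line (\<lambda>n. Uint (- s) (trunc x (r n))) y"
    by (simp add: sq_conv_def o_def)
  \<comment> \<open>The second subsequence is extracted inside the first, so both limits hold along
    \<open>r (q n)\<close>.\<close>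
  from sq_conv_AE_subseq[OF _ _ this] obtain q :: "nat \<Rightarrow> nat" where q: "strict_mono q"
    and q_ae: "AE \<mu> in half_line. (\<lambda>n. Uint (- s) (trunc x (r (q n))) \<mu>) \<longlonglongrightarrow> y \<mu>"
    by auto
  \<comment> \<open>Each \<open>n\<close> has its own exceptional null set; countably many of them
    are merged.\<close>
  have "AE \<mu> in half_line. \<forall>n. p n \<mu> = F_pm (s * \<mu>) * Uint (- s) (trunc x n) \<mu>"
    unfolding AE_all_countable by (intro allI U_ext_FPint FP_dom_trunc U_dom_trunc x p s)
  with r_ae q_ae show ?thesis
  proof eventually_elim
    case (elim \<mu>)
    have "(\<lambda>n. p (r (q n)) \<mu>) \<longlonglongrightarrow> z \<mu>"
      using LIMSEQ_subseq_LIMSEQ[OF elim(1) q] by (simp add: o_def)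
    moreover have "(\<lambda>n. p (r (q n)) \<mu>) \<longlonglongrightarrow> F_pm (s * \<mu>) * y \<mu>"
      using elim(2,3) by (simp add: tendsto_mult_left)
    ultimately show ?case by (rule LIMSEQ_unique)
  qed
qed

lemma AE_half_line: "(AE \<mu> in half_line. P \<mu>) \<longleftrightarrow> (AE \<mu> in lborel. \<mu> > 0 \<longrightarrow> P \<mu>)"
  unfolding half_line_def by (subst AE_restrict_space_iff) auto

theorem theorem3p1:
  fixes x :: "real \<Rightarrow> complex"
  assumes "L2pos x"
  shows "(AE \<mu> in lborel. \<mu> > 0 \<longrightarrow>
            fst (Uop (FPop x)) \<mu> = F_pm \<mu> * snd (Uop x) \<mu>) \<and>
         (AE \<mu> in lborel. \<mu> > 0 \<longrightarrow>
            snd (Uop (FPop x)) \<mu> = F_mp \<mu> * fst (Uop x) \<mu>)"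
proof -
  have FP: "L2pos (FPop x)"
    using is_FP_FPop[OF assms] by (simp add: is_FP_def)
  \<comment> \<open>The case \<open>s = -1\<close> produces \<open>F_pm (- \<mu>)\<close>, which is
    the other entry of the matrix.\<close>
  have F: "F_pm (- \<mu>) = F_mp \<mu>" for \<mu>
    by (simp add: F_pm_def F_mp_def)
  have "AE \<mu> in half_line. fst (Uop (FPop x)) \<mu> = F_pm \<mu> * snd (Uop x) \<mu>"
    using U_ext_FPop[OF assms U_ext_Uop(1)[OF FP] U_ext_Uop(2)[OF assms]] by simp
  moreover have "AE \<mu> in half_line. snd (Uop (FPop x)) \<mu> = F_mp \<mu> * fst (Uop x) \<mu>"
    using U_ext_FPop[of x "-1", OF assms U_ext_Uop(2)[OF FP], of "fst (Uop x)"] U_ext_Uop(1)[OF assms]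
    by (simp add: F)
  ultimately show ?thesis by (simp add: AE_half_line)
qed

end
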